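(* Let $S$ be a finite inverse semigroup with $\mathcal D$-classes $D_0,\dots,D_n$, chosen idempotents $e_j\in D_j$, maximal subgroups $G_j$ of $S$ at $e_j$, and complete sets $\mathrm{IRR}(G_j)$ of inequivalent irreducible representations of $\mathbb C G_j$. Let $\mathcal X$ be any complete set of inequivalent, irreducible matrix representations of $\mathbb C S$. Let $g=\sum_{s\in S}g(s)\lfloor s\rfloor\in\mathbb C S$ and let $s\in D_k$. For $\rho\in\mathrm{IRR}(G_k)$, let $\bar\rho$ denote the corresponding induced representation of $\mathbb C S$ and let $\widetilde\rho\in\mathcal X$ be the representation equivalent to $\bar\rho$. Then \[ g(s)=\frac1{|G_k|}\sum_{\rho\in\mathrm{IRR}(G_k)}d_\rho\,\mathrm{trace}\!\left(\hat g(\widetilde\rho)\,\widetilde\rho(\lfloor s^{-1}\rfloor)\right). \]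
   Context: An inverse semigroup is a semigroup $S$ in which each $x$ has a unique $x^{-1}$ with $xx^{-1}x=x$, $x^{-1}xx^{-1}=x^{-1}$. Write $\mathrm{dom}(s)=s^{-1}s$, $\mathrm{ran}(s)=ss^{-1}$. Natural partial order: $t\leq s$ iff $t=es$ for some idempotent $e$; $\mu$ is its M\"obius function. $s\mathrel{\mathcal D}t$ iff there is $x\in S$ with $\mathrm{dom}(x)=\mathrm{ran}(s)$, $\mathrm{ran}(x)=\mathrm{ran}(t)$ (an equivalence relation with classes the $\mathcal D$-classes). The maximal subgroup at an idempotent $e$ is $\{s\in S:\mathrm{dom}(s)=\mathrm{ran}(s)=e\}$. $r_k$ is the number of idempotents in $D_k$. Groupoid basis: $\lfloor s\rfloor=\sum_{t\leq s}\mu(t,s)t$ for $s\in S$; these form a basis of the semigroup algebra $\mathbb C S$. A representation is an algebra homomorphism to $M_{d_\rho}(\mathbb C)$; a complete set of inequivalent irreducible representations contains exactly one representative of each equivalence class of irreducible representations. Induced representations: for each idempotent $e\in D_k$ fix $p_e\in S$ with $\mathrm{dom}(p_e)=e_k$, $\mathrm{ran}(p_e)=e$, and $p_{e_k}=e_k$. For $\rho\in\mathrm{IRR}(G_k)$, $\bar\rho$ is the (irreducible) representation of $\mathbb C S$ of dimension $r_kd_\rho$ given by $\bar\rho(\lfloor s\rfloor)=E_{\mathrm{ran}(s),\mathrm{dom}(s)}\otimes\rho(p_{\mathrm{ran}(s)}^{-1}\,s\,p_{\mathrm{dom}(s)})$ if $s\in D_k$, and $\bar\rho(\lfloor s\rfloor)=0$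 otherwise, where $E_{a,b}$ are the $r_k\times r_k$ matrix units indexed by idempotents of $D_k$. The $\bar\rho$, over all $k$ and all $\rho\in\mathrm{IRR}(G_k)$, form a complete set of inequivalent irreducible representations of $\mathbb C S$. For $g\in\mathbb C S$ and a representation $\rho$ of $\mathbb C S$, $\hat g(\rho)=\rho(g)$. *)

theory Defs
  imports "Jordan_Normal_Form.VS_Connect"
begin

section \<open>Inverse semigroups\<close>

class inverse_semigroup = semigroup_mult +
  assumes ex1_inverse: "\<exists>!y. x * y * x = x \<and> y * x * y = y"

definition sinv :: "'a::inverse_semigroup \<Rightarrow> 'a" where
  "sinv x = (THE y. x * y * x = x \<and> y * x * y = y)"

definition sdom :: "'a::inverse_semigroup \<Rightarrow> 'a" where
  "sdom s = sinv s * s"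

definition sran :: "'a::inverse_semigroup \<Rightarrow> 'a" where
  "sran s = s * sinv s"

definition idempotents :: "'a::inverse_semigroup set \<Rightarrow> 'a set" where
  "idempotents A = {e \<in> A. e * e = e}"

definition natural_le :: "'a::inverse_semigroup \<Rightarrow> 'a \<Rightarrow> bool" where
  "natural_le t s \<longleftrightarrow> (\<exists>e \<in> idempotents UNIV. t = e * s)"

definition D_rel :: "('a::inverse_semigroup \<times> 'a) set" where
  "D_rel = {(s, t). \<exists>x. sdom x = sran s \<and> sran x = sran t}"

definition max_subgroup :: "'a::inverse_semigroup \<Rightarrow> 'a set" where
  "max_subgroup e = {s. sdom s = e \<and> sran s = e}"


subsection \<open>The natural order is a partial order\<close>

lemma inverse_unique:
  fixes x :: "'a::inverse_semigroup"
  assumes "x * y * x = x" "y * x * y = y" "x * z * x = x" "z * x * z = z"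
  shows "y = z"
  using ex1_inverse[of x] assms by blast

lemma sinv_inverse:
  "x * sinv x * x = x" "sinv x * x * sinv x = sinv x"
  using theI'[OF ex1_inverse[of x]] unfolding sinv_def by blast+

lemma idempotent_mult:
  fixes e f :: "'a::inverse_semigroup"
  assumes e: "e * e = e" and f: "f * f = f"
  shows "(e * f) * (e * f) = e * f"
proof -
  define x where "x = sinv (e * f)"
  have x1: "e * f * x * (e * f) = e * f" and x2: "x * (e * f) * x = x"
    unfolding x_def by (rule sinv_inverse)+
  have e': "e * (e * a) = e * a" and f': "f * (f * a) = f * a" for a
    using e f by (simp_all flip: mult.assoc)
  have x1': "e * (f * (x * (e * f))) = e * f" and x2': "x * (e * (f * x)) = x"
    using x1 x2 by (simp_all only: mult.assoc)
  have x2'': "x * (e * (f * (x * a))) = x * a" for a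
    using arg_cong[OF x2, of "\<lambda>b. b * a"] by (simp only: mult.assoc)
  have "f * x * e = x"
  proof (rule inverse_unique[of "e * f"])
    show "e * f * (f * x * e) * (e * f) = e * f"
      by (simp add: mult.assoc e' f' x1')
    show "f * x * e * (e * f) * (f * x * e) = f * x * e"
      by (simp add: mult.assoc e' f' x2'')
  qed (fact x1 x2)+
  then have x: "x = f * (x * e)"
    by (simp only: mult.assoc)
  have "x * x = f * (x * (e * (f * (x * e))))"
    by (subst (1 2) x) (simp only: mult.assoc)
  also have "\<dots> = x"
    unfolding x2'' by (rule x[symmetric])
  finally have "x * x = x" .
  then have "x = e * f"
    using x1 x2 by - (rule inverse_unique[of x], simp_all only:)
  with \<open>x * x = x\<close> show ?thesis by simp
qed

lemma idempotent_commute: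
  fixes e f :: "'a::inverse_semigroup"
  assumes e: "e * e = e" and f: "f * f = f"
  shows "e * f = f * e"
proof (rule inverse_unique[of "e * f"])
  have e': "e * (e * a) = e * a" and f': "f * (f * a) = f * a" for a
    using e f by (simp_all flip: mult.assoc)
  have ef: "(e * f) * (e * f) = e * f" and fe: "(f * e) * (f * e) = f * e"
    by (rule idempotent_mult[OF e f], rule idempotent_mult[OF f e])
  show "e * f * (e * f) * (e * f) = e * f" "e * f * (e * f) * (e * f) = e * f"
    by (simp_all add: ef)
  show "e * f * (f * e) * (e * f) = e * f"
    using ef by (simp add: mult.assoc e' f')
  show "f * e * (e * f) * (f * e) = f * e"
    using fe by (simp add: mult.assoc e' f')
qed

lemma natural_le_refl: "natural_le s s"
proof -
  have "s * sinv s \<in> idempotents UNIV"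
    by (simp add: idempotents_def sinv_inverse(1) flip: mult.assoc)
  moreover have "s = s * sinv s * s"
    by (simp add: sinv_inverse)
  ultimately show ?thesis
    unfolding natural_le_def by blast
qed

lemma natural_le_trans:
  assumes "natural_le r t" "natural_le t s"
  shows "natural_le r s"
proof -
  obtain e f where e: "e * e = e" "r = e * t" and f: "f * f = f" "t = f * s"
    using assms by (auto simp: natural_le_def idempotents_def)
  have "r = (e * f) * s"
    using e f by (simp add: mult.assoc)
  moreover have "e * f \<in> idempotents UNIV"
    using idempotent_mult[OF e(1) f(1)] by (simp add: idempotents_def)
  ultimately show ?thesis
    unfolding natural_le_def by blast
qed

lemma natural_le_antisym:
  assumes "natural_le s t" "natural_le t s"
  shows "s = t"
proof -
  obtain e f where e: "e * e = e" "s = e * t" and f: "f * f = f" "t = f * s"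
    using assms by (auto simp: natural_le_def idempotents_def)
  have "e * s = s"
    using e by (simp flip: mult.assoc)
  have "f * t = t"
    using f by (metis mult.assoc)
  have "t = f * (e * s)"
    using f(2) \<open>e * s = s\<close> by simp
  also have "\<dots> = e * (f * s)"
    using idempotent_commute[OF e(1) f(1)] by (simp flip: mult.assoc)
  also have "\<dots> = s"
    using e(2) f(2) by simp
  finally show ?thesis ..
qed


subsection \<open>Moebius function and groupoid basis\<close>

function moebius :: "'a::{inverse_semigroup, finite} \<Rightarrow> 'a \<Rightarrow> int" where
  "moebius t s =
     (if t = s then 1
      else if natural_le t s then - (\<Sum>u | natural_le t u \<and> natural_le u s \<and> u \<noteq> s. moebius t u)
      else 0)"
  by auto
termination
proof (relation "measure (\<lambda>(t, s). card {v. natural_le v s})", simp, clarsimp)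
  fix s u :: 'a
  assume "natural_le u s" "u \<noteq> s"
  then have "{v. natural_le v u} \<subset> {v. natural_le v s}"
    using natural_le_refl natural_le_trans natural_le_antisym by blast
  then show "card {v. natural_le v u} < card {v. natural_le v s}"
    by (simp add: psubset_card_mono)
qed

declare moebius.simps [simp del]


section \<open>Semigroup algebras\<close>

text \<open>Elements of the algebra \<open>\<complex>A\<close> of a subsemigroup \<open>A\<close> of \<open>'a\<close> are the functions
  \<open>'a \<Rightarrow> complex\<close> vanishing outside \<open>A\<close>, added and scaled pointwise and multiplied by
  convolution; \<open>single s\<close> is the element \<open>s\<close>.\<close>

definition alg :: "'a set \<Rightarrow> ('a \<Rightarrow> complex) set" where
  "alg A = {f. \<forall>x. x \<notin> A \<longrightarrow> f x = 0}"

definition conv :: "('a::{semigroup_mult, finite} \<Rightarrow> complex) \<Rightarrow> ('a \<Rightarrow> complex) \<Rightarrow> 'a \<Rightarrow> complex" where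
  "conv f g = (\<lambda>z. \<Sum>(x, y) | x * y = z. f x * g y)"

definition single :: "'a \<Rightarrow> 'a \<Rightarrow> complex" where
  "single s = (\<lambda>x. if x = s then 1 else 0)"

definition groupoid_basis :: "'a::{inverse_semigroup, finite} \<Rightarrow> 'a \<Rightarrow> complex" where
  "groupoid_basis s = (\<lambda>x. \<Sum>t | natural_le t s. of_int (moebius t s) * single t x)"

definition groupoid_sum :: "('a::{inverse_semigroup, finite} \<Rightarrow> complex) \<Rightarrow> 'a \<Rightarrow> complex" where
  "groupoid_sum c = (\<lambda>x. \<Sum>s\<in>UNIV. c s * groupoid_basis s x)"

definition groupoid_coeff :: "('a::{inverse_semigroup, finite} \<Rightarrow> complex) \<Rightarrow> 'a \<Rightarrow> complex" where
  "groupoid_coeff f = (THE c. f = groupoid_sum c)"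


section \<open>Matrix representations\<close>

text \<open>Only the values on \<open>alg A\<close> of a representation of \<open>\<complex>A\<close> matter. Its dimension is
  read off from the size of the matrices.\<close>

type_synonym 'a rep = "('a \<Rightarrow> complex) \<Rightarrow> complex mat"

definition rep_dim :: "'a rep \<Rightarrow> nat" where
  "rep_dim \<rho> = dim_row (\<rho> (\<lambda>_. 0))"

definition is_rep :: "'a::{semigroup_mult, finite} set \<Rightarrow> 'a rep \<Rightarrow> bool" where
  "is_rep A \<rho> \<longleftrightarrow>
     (\<forall>f\<in>alg A. \<rho> f \<in> carrier_mat (rep_dim \<rho>) (rep_dim \<rho>)) \<and>
     (\<forall>f\<in>alg A. \<forall>g\<in>alg A. \<rho> (\<lambda>x. f x + g x) = \<rho> f + \<rho> g) \<and>
     (\<forall>c. \<forall>f\<in>alg A. \<rho> (\<lambda>x. c * f x) = c \<cdot>\<^sub>m \<rho> f) \<and>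
     (\<forall>f\<in>alg A. \<forall>g\<in>alg A. \<rho> (conv f g) = \<rho> f * \<rho> g)"

text \<open>Representations are not required to preserve the identity, so the one-dimensional zero
  homomorphism has to be excluded from the irreducible ones (it has no proper nonzero
  invariant subspace). The first conjunct also forces the dimension to be positive.\<close>

definition irreducible_rep :: "'a::{semigroup_mult, finite} set \<Rightarrow> 'a rep \<Rightarrow> bool" where
  "irreducible_rep A \<rho> \<longleftrightarrow> is_rep A \<rho> \<and>
     (\<exists>f\<in>alg A. \<rho> f \<noteq> 0\<^sub>m (rep_dim \<rho>) (rep_dim \<rho>)) \<and>
     (\<forall>W. VectorSpace.subspace class_ring W (module_vec TYPE(complex) (rep_dim \<rho>)) \<and>
          (\<forall>f\<in>alg A. \<forall>v\<in>W. \<rho> f *\<^sub>v v \<in> W) \<longrightarrow>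
          W = {0\<^sub>v (rep_dim \<rho>)} \<or> W = carrier_vec (rep_dim \<rho>))"

definition equiv_rep :: "'a set \<Rightarrow> 'a rep \<Rightarrow> 'a rep \<Rightarrow> bool" where
  "equiv_rep A \<rho> \<sigma> \<longleftrightarrow> (\<exists>P Q. \<forall>f\<in>alg A. similar_mat_wit (\<rho> f) (\<sigma> f) P Q)"

definition complete_irreps :: "'a::{semigroup_mult, finite} set \<Rightarrow> 'a rep set \<Rightarrow> bool" where
  "complete_irreps A X \<longleftrightarrow>
     (\<forall>\<rho>\<in>X. irreducible_rep A \<rho>) \<and>
     (\<forall>\<sigma>. irreducible_rep A \<sigma> \<longrightarrow> (\<exists>!\<rho>. \<rho> \<in> X \<and> equiv_rep A \<sigma> \<rho>))"

definition equiv_rep_in :: "'a set \<Rightarrow> 'a rep set \<Rightarrow> 'a rep \<Rightarrow> 'a rep" where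
  "equiv_rep_in A X \<sigma> = (THE \<rho>. \<rho> \<in> X \<and> equiv_rep A \<sigma> \<rho>)"

definition mat_trace :: "'a::comm_monoid_add mat \<Rightarrow> 'a" where
  "mat_trace M = (\<Sum>i<dim_row M. M $$ (i, i))"


subsection \<open>Induced representations\<close>

definition kronecker :: "'a::times mat \<Rightarrow> 'a mat \<Rightarrow> 'a mat" where
  "kronecker M N = mat (dim_row M * dim_row N) (dim_col M * dim_col N)
     (\<lambda>(i, j). M $$ (i div dim_row N, j div dim_col N) * N $$ (i mod dim_row N, j mod dim_col N))"

text \<open>\<open>ix\<close> enumerates the \<open>r\<close> idempotents that index rows and columns.\<close>

definition matrix_unit :: "nat \<Rightarrow> (nat \<Rightarrow> 'a) \<Rightarrow> 'a \<Rightarrow> 'a \<Rightarrow> complex mat" where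
  "matrix_unit r ix a b = mat r r (\<lambda>(i, j). if ix i = a \<and> ix j = b then 1 else 0)"

definition induced_basis ::
    "'a::{inverse_semigroup, finite} set \<Rightarrow> (nat \<Rightarrow> 'a) \<Rightarrow> ('a \<Rightarrow> 'a) \<Rightarrow> 'a rep \<Rightarrow> 'a \<Rightarrow> complex mat" where
  "induced_basis Dk ix p \<rho> s = (let r = card (idempotents Dk) in
     if s \<in> Dk
     then kronecker (matrix_unit r ix (sran s) (sdom s))
            (\<rho> (single (sinv (p (sran s)) * s * p (sdom s))))
     else 0\<^sub>m (r * rep_dim \<rho>) (r * rep_dim \<rho>))"

text \<open>The linear extension of \<^const>\<open>induced_basis\<close> from the groupoid basis.\<close>

definition induced_rep ::
    "'a::{inverse_semigroup, finite} set \<Rightarrow> (nat \<Rightarrow> 'a) \<Rightarrow> ('a \<Rightarrow> 'a) \<Rightarrow> 'a rep \<Rightarrow> 'a rep" where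
  "induced_rep Dk ix p \<rho> f = (let m = card (idempotents Dk) * rep_dim \<rho> in
     mat m m (\<lambda>ij. \<Sum>s\<in>UNIV. groupoid_coeff f s * induced_basis Dk ix p \<rho> s $$ ij))"

end

theory Submission
  imports Defs "Jordan_Normal_Form.DL_Rank" "Jordan_Normal_Form.Spectral_Radius"
begin

text \<open>
The formula is Fourier inversion for the groupoid underlying \<open>S\<close>, and it reduces to Fourier
inversion at the identity of the finite group \<open>G\<^sub>k\<close>.

In the groupoid basis the product of \<open>\<complex>S\<close> is that of a groupoid: \<open>\<lfloor>s\<rfloor>\<lfloor>t\<rfloor>\<close> is
\<open>\<lfloor>st\<rfloor>\<close> if \<open>dom s = ran t\<close> and \<open>0\<close> otherwise. In terms of coefficients this is
\<open>groupoid_coeff_conv\<close>, which rests on the fact that an element below \<open>xy\<close> factors in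
exactly one way as a composable product of an element below \<open>x\<close> and one below \<open>y\<close>.
It follows that the induced map \<open>\<rho>'\<close> is multiplicative. Its matrices are arrays of blocks
indexed by pairs of idempotents of the \<open>\<D>\<close>-class. The elements with range \<open>a\<close> and
domain \<open>b\<close> are carried bijectively onto \<open>G\<^sub>k\<close> by \<open>s \<mapsto> p\<^sub>a\<^sup>-\<^sup>1 s p\<^sub>b\<close>, so the
block at \<open>(a, b)\<close> can be any matrix in the image of \<open>\<rho>\<close> while all the others vanish.
This makes \<open>\<rho>'\<close> irreducible (\<open>irreducible_\<rho>'\<close>). Hence the representation in
\<open>X\<close> that is equivalent to \<open>\<rho>'\<close> exists, and, traces being invariant under equivalence,
the formula can be checked on \<open>\<rho>'\<close> itself.

The trace of \<open>\<rho>'(\<lfloor>t\<rfloor>\<lfloor>s\<^sup>-\<^sup>1\<rfloor>)\<close> is \<open>0\<close> unless \<open>t\<close> has the same range and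
domain as \<open>s\<close>, and then it is the value of the character of \<open>\<rho>\<close> at an element of
\<open>G\<^sub>k\<close> that is the identity exactly if \<open>t = s\<close>. By \<open>column_orthogonality\<close> the
characters, weighted by the dimensions and summed over \<open>\<rho>\<close>, give \<open>|G\<^sub>k|\<close> at the
identity and \<open>0\<close> elsewhere, so only the coefficient at \<open>s\<close> survives.

Column orthogonality comes from the regular representation, whose trace is \<open>|G|\<close> at the
identity and \<open>0\<close> elsewhere. The trace is additive along invariant subspaces, so it is a sum of
irreducible characters (\<open>trace_composition_series\<close>), and pairing with the character of
\<open>\<rho>\<close> by the orthogonality relations, which follow from Schur's lemma, shows that
\<open>\<rho>\<close> occurs \<open>d\<^sub>\<rho>\<close> times. As \<open>d\<^sub>\<rho> > 0\<close>, every irreducible representation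
occurs, so there are only finitely many and the sum in the formula is a genuine finite sum.
\<close>

section \<open>Inverse semigroups\<close>

lemma sinv_eqI:
  fixes x :: "'a::inverse_semigroup"
  assumes "x * y * x = x" "y * x * y = y"
  shows "sinv x = y"
  using inverse_unique[OF sinv_inverse assms] .

text \<open>The defining equations of the inverse in a form that fires on right-associated products.\<close>
lemma sinv_inverse_assoc:
  fixes x :: "'a::inverse_semigroup"
  shows "x * (sinv x * x) = x" "x * (sinv x * (x * a)) = x * a"
    "sinv x * (x * sinv x) = sinv x" "sinv x * (x * (sinv x * a)) = sinv x * a"
  using sinv_inverse[of x] by (simp_all flip: mult.assoc)

lemma sinv_sinv [simp]: "sinv (sinv x) = x"
  by (rule sinv_eqI) (rule sinv_inverse)+

lemma sdom_idempotent [simp]: "sdom s * sdom s = sdom s"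
  and sran_idempotent [simp]: "sran s * sran s = sran s"
  by (simp_all add: sdom_def sran_def mult.assoc sinv_inverse_assoc)

lemma sinv_idempotent: "e * e = e \<Longrightarrow> sinv e = e"
  by (rule sinv_eqI) simp_all

lemma mult_sdom [simp]: "s * sdom s = s" and sran_mult [simp]: "sran s * s = s"
  by (simp_all add: sdom_def sran_def mult.assoc sinv_inverse_assoc)

lemma sdom_sran_commute:
  fixes x y :: "'a::inverse_semigroup"
  shows "sdom x * sran y = sran y * sdom x"
  by (rule idempotent_commute) simp_all

text \<open>The idempotents \<open>sran y\<close> and \<open>sdom x\<close>, which meet in the middle of
  \<open>x y y\<^sup>-\<^sup>1 x\<^sup>-\<^sup>1 x y\<close>, commute.\<close>
lemma sinv_mult: "sinv (x * y) = sinv y * sinv x"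
proof (rule sinv_eqI)
  have "x * y * (sinv y * sinv x) * (x * y) = x * (sran y * sdom x) * y"
    by (simp add: sdom_def sran_def mult.assoc)
  also have "\<dots> = x * sdom x * (sran y * y)"
    by (simp only: mult.assoc flip: sdom_sran_commute)
  finally show "x * y * (sinv y * sinv x) * (x * y) = x * y"
    by simp
  have "sinv y * sinv x * (x * y) * (sinv y * sinv x) = sinv y * (sdom x * sran y) * sinv x"
    by (simp add: sdom_def sran_def mult.assoc)
  also have "\<dots> = (sinv y * sran y) * (sdom x * sinv x)"
    by (simp only: mult.assoc sdom_sran_commute)
  finally show "sinv y * sinv x * (x * y) * (sinv y * sinv x) = sinv y * sinv x"
    by (simp add: sdom_def sran_def mult.assoc sinv_inverse_assoc)
qed

lemma sdom_sinv [simp]: "sdom (sinv s) = sran s" and sran_sinv [simp]: "sran (sinv s) = sdom s"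
  by (simp_all add: sdom_def sran_def)

lemma sdom_of_idempotent: "e * e = e \<Longrightarrow> sdom e = e"
  and sran_of_idempotent: "e * e = e \<Longrightarrow> sran e = e"
  by (simp_all add: sdom_def sran_def sinv_idempotent)

text \<open>If \<open>dom s = ran t\<close>, the product \<open>st\<close> is a composition of arrows
  \<open>dom t \<rightarrow> ran t = dom s \<rightarrow> ran s\<close> in the groupoid underlying the semigroup.\<close>
lemma composable:
  assumes "sdom s = sran t"
  shows sdom_composable: "sdom (s * t) = sdom t" and sran_composable: "sran (s * t) = sran s"
proof -
  have "sdom (s * t) = sinv t * sdom s * t"
    by (simp add: sdom_def sinv_mult mult.assoc)
  also have "\<dots> = sinv t * (sran t * t)"
    by (simp only: assms mult.assoc)
  finally show "sdom (s * t) = sdom t"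
    by (simp add: sdom_def)
  have "sran (s * t) = s * sran t * sinv s"
    by (simp add: sran_def sinv_mult mult.assoc)
  also have "\<dots> = s * sdom s * sinv s"
    by (simp only: assms)
  finally show "sran (s * t) = sran s"
    by (simp add: sran_def)
qed

lemma idempotent_conjugate:
  assumes "e * e = e"
  shows "(sinv x * e * x) * (sinv x * e * x) = sinv x * e * x"
proof -
  have "(sinv x * e * x) * (sinv x * e * x) = sinv x * (e * sran x) * (e * x)"
    by (simp add: sran_def mult.assoc)
  also have "e * sran x = sran x * e"
    using assms by (intro idempotent_commute) simp_all
  also have "sinv x * (sran x * e) * (e * x) = (sinv x * sran x) * ((e * e) * x)"
    by (simp only: mult.assoc)
  finally show ?thesis
    using assms by (simp add: sran_def mult.assoc sinv_inverse_assoc)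
qed

text \<open>The idempotent in the definition of the natural order can always be chosen canonically, and
  it can be put on either side.\<close>
lemma natural_le_iff_left: "natural_le t s \<longleftrightarrow> t = sran t * s"
proof
  assume "natural_le t s"
  then obtain e where e: "e * e = e" "t = e * s"
    by (auto simp: natural_le_def idempotents_def)
  have "sran t = e * sran s * e"
    using e sinv_idempotent[of e] by (simp add: sran_def sinv_mult mult.assoc)
  also have "\<dots> = e * (sran s * e)" by (rule mult.assoc)
  also have "\<dots> = e * (e * sran s)"
    using e(1) by (subst idempotent_commute[of "sran s" e]) simp_all
  also have "\<dots> = e * sran s"
    using e(1) by (simp flip: mult.assoc)
  finally have "sran t * s = e * (sran s * s)"
    by (simp only: mult.assoc)
  then show "t = sran t * s" using e by simp
next
  assume "t = sran t * s"
  then show "natural_le t s"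
    unfolding natural_le_def idempotents_def by (intro bexI[of _ "sran t"]) simp_all
qed

lemma natural_le_iff_right: "natural_le t s \<longleftrightarrow> t = s * sdom t"
proof -
  have right: "x = y * sdom x" if "natural_le x y" for x y :: 'a
  proof -
    from that obtain e where e: "e * e = e" "x = e * y"
      by (auto simp: natural_le_def idempotents_def)
    have "y * sdom x = (sran y * e) * y"
      using e sinv_idempotent[of e] by (simp add: sdom_def sran_def sinv_mult mult.assoc flip: mult.assoc[of e e])
    also have "sran y * e = e * sran y"
      using e by (intro idempotent_commute) simp_all
    finally show ?thesis using e by (simp add: mult.assoc)
  qed
  have "natural_le (sinv t) (sinv s)" if "t = s * sdom t"
  proof -
    have "sinv t = sinv (s * sdom t)" using that by simp
    also have "\<dots> = sran (sinv t) * sinv s"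
      by (simp add: sinv_mult sinv_idempotent)
    finally show ?thesis by (simp only: natural_le_iff_left)
  qed
  moreover have "natural_le (sinv x) (sinv y)" if "natural_le x y" for x y :: 'a
  proof -
    have "sinv x = sinv (y * sdom x)" using right[OF that] by simp
    also have "\<dots> = sran (sinv x) * sinv y"
      by (simp add: sinv_mult sinv_idempotent)
    finally show ?thesis by (simp only: natural_le_iff_left)
  qed
  ultimately show ?thesis
    using right by (metis sinv_sinv)
qed

lemma natural_le_mult:
  assumes "natural_le t x" "natural_le u y"
  shows "natural_le (t * u) (x * y)"
proof -
  have tu: "t * u = sran t * (x * (y * sdom u))"
    using assms by (metis natural_le_iff_left natural_le_iff_right mult.assoc)
  have "natural_le (x * y * sdom u) (x * y)"
  proof -
    let ?z = "x * y * sdom u"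
    have "sdom ?z = sdom u * sdom (x * y) * sdom u"
      by (simp add: sdom_def sinv_mult mult.assoc)
    also have "\<dots> = sdom (x * y) * (sdom u * sdom u)"
      by (subst idempotent_commute[of "sdom u" "sdom (x * y)"]) (simp_all add: mult.assoc)
    finally have "x * y * sdom ?z = (x * y * sdom (x * y)) * sdom u"
      by (simp only: mult.assoc sdom_idempotent)
    then have "x * y * sdom ?z = ?z" by (simp only: mult_sdom)
    then show ?thesis unfolding natural_le_iff_right by simp
  qed
  moreover have "natural_le (t * u) (x * y * sdom u)"
    unfolding natural_le_def idempotents_def
    by (rule bexI[of _ "sran t"]) (simp_all add: tu mult.assoc)
  ultimately show ?thesis by (rule natural_le_trans[rotated])
qed

text \<open>The next two lemmas show that every \<open>v \<le> xy\<close> has exactly one factorisation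
  \<open>v = tu\<close> with \<open>t \<le> x\<close>, \<open>u \<le> y\<close> and \<open>dom t = ran u\<close>. In a composable
  product, \<open>t\<close> has the range of \<open>v\<close> and \<open>u\<close> its domain, and an element below
  \<open>x\<close> is determined by its range or by its domain.\<close>
lemma composable_below_unique:
  assumes "natural_le t x" "natural_le u y" "sdom t = sran u"
  shows "t = sran (t * u) * x" and "u = y * sdom (t * u)"
  using assms by (simp_all add: sdom_composable sran_composable
      flip: natural_le_iff_left natural_le_iff_right)

text \<open>With \<open>c = x\<^sup>-\<^sup>1 ran(v) x\<close>, both \<open>dom t\<close> and \<open>ran u\<close> turn out to be
  \<open>c ran(y)\<close>.\<close>
lemma composable_below_exists:
  assumes "natural_le v (x * y)"
  defines "t \<equiv> sran v * x" and "u \<equiv> y * sdom v"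
  shows "natural_le t x" "natural_le u y" "sdom t = sran u" "t * u = v"
proof -
  have v1: "v = sran v * (x * y)" and v2: "v = x * y * sdom v"
    using assms natural_le_iff_left natural_le_iff_right by blast+
  show "natural_le t x"
    unfolding natural_le_def idempotents_def t_def by (rule bexI[of _ "sran v"]) simp_all
  have "natural_le (sinv u) (sinv y)"
    unfolding natural_le_def idempotents_def u_def
    by (rule bexI[of _ "sdom v"]) (simp_all add: sinv_mult sinv_idempotent)
  then show "natural_le u y"
    by (metis natural_le_iff_left natural_le_iff_right sinv_mult sinv_sinv sinv_idempotent sran_sinv sdom_idempotent)
  have "t * u = sran v * (x * y * sdom v)" by (simp add: t_def u_def mult.assoc)
  then show "t * u = v" by (simp flip: v2)
  let ?c = "sinv x * sran v * x"
  have c: "?c * ?c = ?c" by (rule idempotent_conjugate) simp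
  have cx: "?c * sdom x = ?c" by (simp add: sdom_def mult.assoc sinv_inverse_assoc)
  have "sdom t = ?c"
    by (simp add: t_def sdom_def[of "sran v * x"] sinv_mult sinv_idempotent mult.assoc flip: mult.assoc[of "sran v" "sran v"])
  have "sran v = sran v * (x * sran y * sinv x) * sran v"
    using arg_cong[OF v1, of sran]
    by (simp add: sran_def[of "sran v * (x * y)"] sinv_mult sinv_idempotent mult.assoc)
       (simp add: sran_def mult.assoc)
  then have "?c = sinv x * (sran v * (x * sran y * sinv x) * sran v) * x" by simp
  also have "\<dots> = ?c * (sran y * ?c)" by (simp add: mult.assoc)
  also have "sran y * ?c = ?c * sran y"
    by (rule idempotent_commute) (simp_all add: c)
  also have "?c * (?c * sran y) = (?c * ?c) * sran y"
    by (rule mult.assoc[symmetric])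
  also have "?c * ?c = ?c" by (rule c)
  finally have cy: "?c * sran y = ?c" by simp
  have dv: "sdom v = sinv y * ?c * y"
    using arg_cong[OF v1, of sdom]
    by (simp add: sdom_def[of "sran v * (x * y)"] sinv_mult sinv_idempotent mult.assoc flip: mult.assoc[of "sran v" "sran v"])
  have "sran u = y * sdom v * sinv y"
    by (simp add: u_def sran_def[of "y * sdom v"] sinv_mult sinv_idempotent mult.assoc flip: mult.assoc[of "sdom v" "sdom v"])
  also have "\<dots> = sran y * (?c * sran y)"
    by (simp add: dv sran_def mult.assoc)
  also have "\<dots> = ?c * sran y"
    by (subst idempotent_commute[of "sran y"]) (simp_all add: c cy)
  finally show "sdom t = sran u"
    using \<open>sdom t = ?c\<close> cy by simp
qed

section \<open>Moebius inversion and the groupoid basis\<close>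

lemma sum_moebius:
  "(\<Sum>u | natural_le t u \<and> natural_le u s. moebius t u) = (if t = s then 1 else 0)"
proof (cases "natural_le t s")
  case True
  have "(\<Sum>u | natural_le t u \<and> natural_le u s. moebius t u)
    = moebius t s + (\<Sum>u | natural_le t u \<and> natural_le u s \<and> u \<noteq> s. moebius t u)"
    using True natural_le_refl[of s] by (subst sum.remove[of _ s]) (auto intro!: sum.cong)
  moreover have "(\<Sum>u | natural_le t u \<and> natural_le u s \<and> u \<noteq> s. moebius t u) = 0" if "t = s"
    using that natural_le_antisym by (intro sum.neutral) blast
  ultimately show ?thesis
    using True by (subst (asm) (2) moebius.simps) auto
next
  case False
  then have "(\<Sum>u | natural_le t u \<and> natural_le u s. moebius t u) = 0"
    using natural_le_trans by (intro sum.neutral) blast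
  then show ?thesis using False natural_le_refl by auto
qed

lemma moebius_not_le: "\<not> natural_le t s \<Longrightarrow> moebius t s = 0"
  using natural_le_refl by (subst moebius.simps) auto

lemma moebius_nonzero_imp_le: "moebius t s \<noteq> 0 \<Longrightarrow> natural_le t s"
  using moebius_not_le by blast

lemma moebius_refl: "moebius s s = 1"
  by (subst moebius.simps) simp

lemma groupoid_basis_apply: "groupoid_basis s x = of_int (moebius x s)"
proof -
  have "groupoid_basis s x = (\<Sum>t\<in>{t. natural_le t s}. if t = x then of_int (moebius t s) else 0)"
    unfolding groupoid_basis_def single_def by (intro sum.cong) auto
  then show ?thesis by (auto simp: moebius_not_le)
qed

lemma single_eq_sum_groupoid_basis:
  "single s x = (\<Sum>u | natural_le u s. groupoid_basis u x)"
proof -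
  have "(\<Sum>u | natural_le u s. moebius x u) = (\<Sum>u | natural_le x u \<and> natural_le u s. moebius x u)"
    by (rule sum.mono_neutral_right) (auto dest: moebius_nonzero_imp_le)
  also have "\<dots> = (if x = s then 1 else 0)" by (rule sum_moebius)
  finally have "(\<Sum>u | natural_le u s. of_int (moebius x u)) = (if x = s then 1 else 0 :: complex)"
    by (metis of_int_sum of_int_0 of_int_1)
  then show ?thesis by (simp add: single_def groupoid_basis_apply)
qed

text \<open>The passage to the groupoid basis is unitriangular: at an element \<open>s\<close> that is maximal
  among those where \<open>c\<close> and \<open>d\<close> differ, all other terms vanish.\<close>
lemma groupoid_sum_inj:
  assumes "groupoid_sum c = groupoid_sum d"
  shows "c = d"
proof (rule ccontr)
  assume "c \<noteq> d"
  then have "{s. c s \<noteq> d s} \<noteq> {}" by auto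
  then obtain s where s: "c s \<noteq> d s" and max: "\<And>u. c u \<noteq> d u \<Longrightarrow> natural_le s u \<Longrightarrow> u = s"
  proof -
    \<comment> \<open>Among these elements, one with the fewest elements above it is maximal.\<close>
    define m where "m s = card {u. natural_le s u}" for s :: 'a
    obtain s where s: "s \<in> {s. c s \<noteq> d s}" "\<And>u. u \<in> {s. c s \<noteq> d s} \<Longrightarrow> m s \<le> m u"
      using \<open>{s. c s \<noteq> d s} \<noteq> {}\<close> ex_has_least_nat[of "\<lambda>s. s \<in> {s. c s \<noteq> d s}" _ m] by blast
    have "u = s" if "c u \<noteq> d u" "natural_le s u" for u
    proof (rule ccontr)
      assume "u \<noteq> s"
      then have "{v. natural_le u v} \<subset> {v. natural_le s v}"
        using that natural_le_refl natural_le_trans natural_le_antisym by blast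
      then have "m u < m s" unfolding m_def by (simp add: psubset_card_mono)
      with s(2) that show False by force
    qed
    with s(1) show ?thesis using that by blast
  qed
  have "groupoid_sum c s - groupoid_sum d s = (\<Sum>u\<in>UNIV. (c u - d u) * groupoid_basis u s)"
    by (simp add: groupoid_sum_def left_diff_distrib sum_subtractf)
  also have "\<dots> = (\<Sum>u\<in>{s}. (c u - d u) * groupoid_basis u s)"
    using max by (intro sum.mono_neutral_right) (auto simp: groupoid_basis_apply dest: moebius_nonzero_imp_le)
  also have "\<dots> = c s - d s" by (simp add: groupoid_basis_apply moebius_refl)
  finally show False using assms s by simp
qed

lemma groupoid_coeff_groupoid_sum: "groupoid_coeff (groupoid_sum c) = c"
  unfolding groupoid_coeff_def by (rule the_equality) (auto dest: groupoid_sum_inj)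

text \<open>Moebius inversion: \<open>s\<close> is the sum of the \<open>\<lfloor>t\<rfloor>\<close> with \<open>t \<le> s\<close>.\<close>
lemma groupoid_coeff_eq: "groupoid_coeff f = (\<lambda>t. \<Sum>s | natural_le t s. f s)"
proof -
  have "f = groupoid_sum (\<lambda>t. \<Sum>s | natural_le t s. f s)"
  proof
    fix x
    have "f x = (\<Sum>s\<in>UNIV. f s * single s x)" by (simp add: single_def if_distrib cong: if_cong)
    also have "\<dots> = (\<Sum>s\<in>UNIV. \<Sum>t\<in>{t. natural_le t s}. f s * groupoid_basis t x)"
      by (simp add: single_eq_sum_groupoid_basis sum_distrib_left)
    also have "\<dots> = (\<Sum>s\<in>UNIV. \<Sum>t\<in>UNIV. if natural_le t s then f s * groupoid_basis t x else 0)"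
      by (simp add: sum.If_cases)
    also have "\<dots> = (\<Sum>t\<in>UNIV. \<Sum>s\<in>UNIV. if natural_le t s then f s * groupoid_basis t x else 0)"
      by (rule sum.swap)
    also have "\<dots> = groupoid_sum (\<lambda>t. \<Sum>s | natural_le t s. f s) x"
      by (simp add: groupoid_sum_def sum_distrib_right sum.If_cases)
    finally show "f x = groupoid_sum (\<lambda>t. \<Sum>s | natural_le t s. f s) x" .
  qed
  then show ?thesis using groupoid_coeff_groupoid_sum by metis
qed

text \<open>The product of the algebra in the groupoid basis is the convolution of a groupoid. Expanding
  both sides into sums over pairs \<open>(x, y)\<close>, the coefficient of \<open>f x * g y\<close> is on the left
  whether \<open>v \<le> xy\<close> and on the right the number of composable factorisations of \<open>v\<close> below
  \<open>(x, y)\<close>; by the unique factorisation these agree.\<close>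
lemma groupoid_coeff_conv:
  "groupoid_coeff (conv f g) v
    = (\<Sum>(t, u) | sdom t = sran u \<and> t * u = v. groupoid_coeff f t * groupoid_coeff g u)"
proof -
  define C where "C = {(t, u). sdom t = sran u \<and> t * u = v}"
  define M where "M x y = {p \<in> C. natural_le (fst p) x \<and> natural_le (snd p) y}" for x y
  have card: "card (M x y) = (if natural_le v (x * y) then 1 else 0)" for x y
  proof (cases "natural_le v (x * y)")
    case True
    have "M x y = {(sran v * x, y * sdom v)}"
      using composable_below_exists[OF True] composable_below_unique
      by (auto simp: M_def C_def)
    then show ?thesis using True by simp
  next
    case False
    then have "M x y = {}" using natural_le_mult by (auto simp: M_def C_def)
    then show ?thesis using False by simp
  qed
  have "groupoid_coeff (conv f g) v = (\<Sum>z | natural_le v z. \<Sum>p | fst p * snd p = z. f (fst p) * g (snd p))"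
    by (simp add: groupoid_coeff_eq conv_def case_prod_beta')
  also have "\<dots> = (\<Sum>z\<in>UNIV. \<Sum>p | p \<in> UNIV \<and> fst p * snd p = z.
      if natural_le v (fst p * snd p) then f (fst p) * g (snd p) else 0)"
    by (rule sum.mono_neutral_cong_left) auto
  also have "\<dots> = (\<Sum>p\<in>UNIV. if natural_le v (fst p * snd p) then f (fst p) * g (snd p) else 0)"
    by (rule sum.group) simp_all
  also have "\<dots> = (\<Sum>p\<in>UNIV. of_nat (card (M (fst p) (snd p))) * (f (fst p) * g (snd p)))"
    by (intro sum.cong) (simp_all add: card)
  also have "\<dots> = (\<Sum>p\<in>UNIV. \<Sum>q\<in>C. if natural_le (fst q) (fst p) \<and> natural_le (snd q) (snd p)
      then f (fst p) * g (snd p) else 0)"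
    by (simp add: M_def sum.If_cases Int_def conj_commute)
  also have "\<dots> = (\<Sum>q\<in>C. \<Sum>p\<in>UNIV. if natural_le (fst q) (fst p) \<and> natural_le (snd q) (snd p)
      then f (fst p) * g (snd p) else 0)"
    by (rule sum.swap)
  also have "\<dots> = (\<Sum>q\<in>C. groupoid_coeff f (fst q) * groupoid_coeff g (snd q))"
  proof (rule sum.cong[OF refl])
    fix q
    have "(\<Sum>p\<in>UNIV. if natural_le (fst q) (fst p) \<and> natural_le (snd q) (snd p)
      then f (fst p) * g (snd p) else 0) =
      (\<Sum>p\<in>{x. natural_le (fst q) x} \<times> {y. natural_le (snd q) y}. f (fst p) * g (snd p))"
      by (simp add: sum.If_cases) (rule sum.cong, auto)
    also have "\<dots> = groupoid_coeff f (fst q) * groupoid_coeff g (snd q)"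
      by (simp add: groupoid_coeff_eq sum_product sum.cartesian_product case_prod_beta')
    finally show "(\<Sum>p\<in>UNIV. if natural_le (fst q) (fst p) \<and> natural_le (snd q) (snd p)
      then f (fst p) * g (snd p) else 0) = groupoid_coeff f (fst q) * groupoid_coeff g (snd q)" .
  qed
  finally show ?thesis by (simp add: C_def case_prod_beta')
qed

section \<open>Matrices, traces and invariant subspaces\<close>

lemma sum_lessThan_split:
  fixes h :: "nat \<Rightarrow> 'b::comm_monoid_add"
  assumes "m \<le> n"
  shows "(\<Sum>l<n. h l) = (\<Sum>l<m. h l) + (\<Sum>l<n - m. h (l + m))"
proof -
  have "(\<Sum>l<n. h l) = (\<Sum>l\<in>{0..<m}. h l) + (\<Sum>l\<in>{0 + m..<(n - m) + m}. h l)"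
    using assms by (simp add: sum.atLeastLessThan_concat flip: atLeast0LessThan)
  then show ?thesis
    by (simp only: sum.shift_bounds_nat_ivl atLeast0LessThan)
qed

text \<open>Summation over the rows of a Kronecker product with blocks of size \<open>d\<close>.\<close>
lemma sum_lessThan_mult:
  fixes F :: "nat \<Rightarrow> nat \<Rightarrow> 'b::comm_monoid_add"
  shows "(\<Sum>l<r * d. F (l div d) (l mod d)) = (\<Sum>a<r. \<Sum>b<d. F a b)"
proof -
  have "(\<Sum>l<r * d. F (l div d) (l mod d)) = (\<Sum>(a, b)\<in>{..<r} \<times> {..<d}. F a b)"
  proof (rule sum.reindex_bij_witness[where j = "\<lambda>l. (l div d, l mod d)" and i = "\<lambda>(a, b). a * d + b"])
    fix q assume "q \<in> {..<r} \<times> {..<d}"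
    then obtain a b where q: "q = (a, b)" "a < r" "b < d" by auto
    have "a * d + b < a * d + d" using q by simp
    also have "\<dots> = Suc a * d" by simp
    also have "\<dots> \<le> r * d" using q by (intro mult_le_mono1) simp
    finally show "(case q of (a, b) \<Rightarrow> a * d + b) \<in> {..<r * d}" using q by simp
    show "((case q of (a, b) \<Rightarrow> a * d + b) div d, (case q of (a, b) \<Rightarrow> a * d + b) mod d) = q"
      using q by simp
  next
    fix l assume l: "l \<in> {..<r * d}"
    then have "d > 0" by (cases d) auto
    then show "(l div d, l mod d) \<in> {..<r} \<times> {..<d}"
      using l by (auto simp: less_mult_imp_div_less)
  qed (auto simp: case_prod_beta')
  then show ?thesis by (simp add: sum.cartesian_product)
qed

lemma sum_list_map_eq_sum_count_list:
  fixes F :: "'b \<Rightarrow> 'c::semiring_1"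
  assumes "finite S" "set xs \<subseteq> S"
  shows "(\<Sum>x\<leftarrow>xs. F x) = (\<Sum>x\<in>S. of_nat (count_list xs x) * F x)"
  using assms(2)
proof (induction xs)
  case (Cons y xs)
  have "(\<Sum>x\<in>S. of_nat (count_list (y # xs) x) * F x)
    = (\<Sum>x\<in>S. (if x = y then F x else 0) + of_nat (count_list xs x) * F x)"
    by (intro sum.cong) (auto simp: algebra_simps)
  then show ?case using Cons assms(1) by (simp add: sum.distrib)
qed simp

lemma mat_mult_entry:
  assumes "A \<in> carrier_mat m n" "B \<in> carrier_mat n p" "i < m" "j < p"
  shows "(A * B) $$ (i, j) = (\<Sum>l<n. A $$ (i, l) * B $$ (l, j))"
  using assms by (simp add: scalar_prod_def atLeast0LessThan)

lemma mult_mat_vec_entry: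
  assumes "A \<in> carrier_mat m n" "v \<in> carrier_vec n" "i < m"
  shows "(A *\<^sub>v v) $ i = (\<Sum>l<n. A $$ (i, l) * v $ l)"
  using assms by (simp add: scalar_prod_def atLeast0LessThan)

lemma mat_mult_unit_vec:
  fixes A :: "'b::semiring_1 mat"
  assumes "A \<in> carrier_mat m n" "i < m" "j < n"
  shows "(A *\<^sub>v unit_vec n j) $ i = A $$ (i, j)"
proof -
  have "(A *\<^sub>v unit_vec n j) $ i = (\<Sum>l<n. A $$ (i, l) * (if l = j then 1 else 0))"
    using assms by (subst mult_mat_vec_entry) (auto intro!: sum.cong simp: unit_vec_def)
  also have "\<dots> = A $$ (i, j)"
    using assms by (simp add: if_distrib cong: if_cong)
  finally show ?thesis .
qed

lemma eq_matI_mult_vec: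
  fixes A B :: "'b::semiring_1 mat"
  assumes "A \<in> carrier_mat m n" "B \<in> carrier_mat m n"
    and "\<And>v. v \<in> carrier_vec n \<Longrightarrow> A *\<^sub>v v = B *\<^sub>v v"
  shows "A = B"
proof (rule eq_matI)
  fix i j assume "i < dim_row B" "j < dim_col B"
  then have ij: "i < m" "j < n" using assms(2) by auto
  show "A $$ (i, j) = B $$ (i, j)"
    using mat_mult_unit_vec[OF assms(1) ij] mat_mult_unit_vec[OF assms(2) ij]
      assms(3)[of "unit_vec n j"] by simp
qed (use assms in auto)

lemma zero_mat_mult_vec:
  fixes v :: "'b::semiring_0 vec"
  shows "v \<in> carrier_vec n \<Longrightarrow> 0\<^sub>m m n *\<^sub>v v = 0\<^sub>v m"
  by (intro eq_vecI) (auto simp: scalar_prod_def)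

lemma smult_mat_mult_vec:
  fixes A :: "'b::comm_semiring_0 mat"
  assumes "A \<in> carrier_mat m n" "v \<in> carrier_vec n"
  shows "(c \<cdot>\<^sub>m A) *\<^sub>v v = c \<cdot>\<^sub>v (A *\<^sub>v v)"
  using assms by (intro eq_vecI) (auto simp: scalar_prod_def sum_distrib_left mult.assoc)

lemma mat_trace_mult_comm:
  fixes A :: "'b::comm_semiring_0 mat"
  assumes "A \<in> carrier_mat m n" "B \<in> carrier_mat n m"
  shows "mat_trace (A * B) = mat_trace (B * A)"
proof -
  have "mat_trace (A * B) = (\<Sum>i<m. \<Sum>j<n. A $$ (i, j) * B $$ (j, i))"
    using assms by (simp add: mat_trace_def mat_mult_entry del: index_mult_mat(1))
  also have "\<dots> = (\<Sum>j<n. \<Sum>i<m. B $$ (j, i) * A $$ (i, j))"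
    by (subst sum.swap) (simp add: mult.commute)
  also have "\<dots> = mat_trace (B * A)"
    using assms by (simp add: mat_trace_def mat_mult_entry del: index_mult_mat(1))
  finally show ?thesis .
qed

lemma mat_trace_conjugate:
  fixes M :: "'b::comm_semiring_1 mat"
  assumes "M \<in> carrier_mat n n" "P \<in> carrier_mat m n" "Q \<in> carrier_mat n m" "Q * P = 1\<^sub>m n"
  shows "mat_trace (P * M * Q) = mat_trace M"
proof -
  have "mat_trace (P * M * Q) = mat_trace (Q * (P * M))"
    using assms by (intro mat_trace_mult_comm) auto
  also have "Q * (P * M) = M"
    using assms by (subst assoc_mult_mat[symmetric]) auto
  finally show ?thesis .
qed

lemma subspaceI:
  fixes W :: "'b::field vec set"
  assumes W: "W \<subseteq> carrier_vec n" "0\<^sub>v n \<in> W"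
    and add: "\<And>v w. v \<in> W \<Longrightarrow> w \<in> W \<Longrightarrow> v + w \<in> W"
    and smult: "\<And>c v. v \<in> W \<Longrightarrow> c \<cdot>\<^sub>v v \<in> W"
  shows "VectorSpace.subspace class_ring W (module_vec TYPE('b) n)"
proof -
  interpret vec_space "TYPE('b)" n .
  show ?thesis
    unfolding VectorSpace.subspace_def
    using assms vec_vs vec_module
    by (auto simp: LinearCombinations.submodule_def module_vec_simps)
qed

lemma subspaceD:
  fixes W :: "'b::field vec set"
  assumes "VectorSpace.subspace class_ring W (module_vec TYPE('b) n)"
  shows "W \<subseteq> carrier_vec n" "0\<^sub>v n \<in> W"
    and "\<And>v w. v \<in> W \<Longrightarrow> w \<in> W \<Longrightarrow> v + w \<in> W"
    and "\<And>c v. v \<in> W \<Longrightarrow> c \<cdot>\<^sub>v v \<in> W"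
  using assms
  by (auto simp: VectorSpace.subspace_def LinearCombinations.submodule_def module_vec_simps class_ring_simps)

text \<open>A basis of \<open>W\<close> extended to one of the whole space: the first \<open>m\<close> columns of
  \<open>P\<close> span \<open>W\<close>, so membership in \<open>W\<close> means that the coordinates from \<open>m\<close> on
  vanish.\<close>
lemma adapted_basis:
  fixes W :: "'b::field vec set"
  assumes W: "VectorSpace.subspace class_ring W (module_vec TYPE('b) n)"
  obtains m P Q where "m \<le> n" "P \<in> carrier_mat n n" "Q \<in> carrier_mat n n"
    "P * Q = 1\<^sub>m n" "Q * P = 1\<^sub>m n"
    "\<And>v. v \<in> carrier_vec n \<Longrightarrow> v \<in> W \<longleftrightarrow> (\<forall>i. m \<le> i \<and> i < n \<longrightarrow> (Q *\<^sub>v v) $ i = 0)"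
proof -
  interpret vec_space "TYPE('b)" n .
  have WC: "W \<subseteq> carrier_vec n" by (rule subspaceD[OF W])
  have Wsub: "LinearCombinations.submodule class_ring W V"
    using W by (simp add: VectorSpace.subspace_def)
  have bound: "finite S \<and> card S \<le> n" if "S \<subseteq> carrier_vec n" "lin_indpt S" for S
    using li_le_dim[OF fin_dim] that by (simp add: dim_is_n)
  have empty: "lin_indpt {}" by (rule finite_lin_indpt2) auto
  have "\<exists>B. finite B \<and> maximal B (\<lambda>S. S \<subseteq> W \<and> lin_indpt S)"
    by (rule maximal_exists[of _ n "{}"]) (use bound WC empty in blast)+
  then obtain B where B: "finite B" "maximal B (\<lambda>S. S \<subseteq> W \<and> lin_indpt S)"
    by blast
  have BW: "B \<subseteq> W" and Bi: "lin_indpt B" using B(2) by (auto simp: maximal_def)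
  have spanB: "w \<in> span B" if "w \<in> W" for w
  proof (cases "w \<in> B")
    case True
    then show ?thesis using span_mem BW WC by simp
  next
    case False
    have "lin_dep (B \<union> {w})"
    proof (rule ccontr)
      assume "lin_indpt (B \<union> {w})"
      then have "B \<union> {w} = B"
        using B(2) BW that unfolding maximal_def by blast
      with False show False by blast
    qed
    then show ?thesis
      using lin_dep_iff_in_span[of B w] BW WC Bi that False by auto
  qed
  have "\<exists>C. finite C \<and> maximal C (\<lambda>S. B \<subseteq> S \<and> S \<subseteq> carrier_vec n \<and> lin_indpt S)"
    by (rule maximal_exists[of _ n B]) (use bound BW WC Bi in blast)+
  then obtain C where C: "finite C" "maximal C (\<lambda>S. B \<subseteq> S \<and> S \<subseteq> carrier_vec n \<and> lin_indpt S)"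
    by blast
  have CB: "B \<subseteq> C" and CC: "C \<subseteq> carrier_vec n" and Ci: "lin_indpt C"
    using C(2) by (auto simp: maximal_def)
  have "maximal C (\<lambda>S. S \<subseteq> carrier_vec n \<and> lin_indpt S)"
    unfolding maximal_def
  proof (intro conjI allI impI)
    fix S assume S: "C \<subseteq> S \<and> S \<subseteq> carrier_vec n \<and> lin_indpt S"
    then have "B \<subseteq> S" using CB by blast
    then show "S = C" using C(2) S unfolding maximal_def by simp
  qed (simp_all add: CC Ci)
  then have "basis C" by (rule max_li_is_basis)
  then have cardC: "card C = n" using dim_basis[OF C(1)] dim_is_n by simp
  obtain bs where bs: "set bs = B" "distinct bs" using B(1) finite_distinct_list by blast
  obtain cs where cs: "set cs = C - B" "distinct cs" using C(1) finite_distinct_list by blast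
  define us where "us = bs @ cs"
  define m where "m = length bs"
  have us: "set us = C" "distinct us" using bs cs CB by (auto simp: us_def)
  have len: "length us = n" using us cardC distinct_card by metis
  have us_B: "us ! i \<in> B \<longleftrightarrow> i < m" if "i < n" for i
  proof (cases "i < m")
    case True
    then show ?thesis using bs(1) nth_mem[of i bs] by (simp add: us_def m_def nth_append)
  next
    case False
    then have "i - m < length cs" using that len by (simp add: us_def m_def)
    then show ?thesis using False cs(1) nth_mem[of "i - m" cs] by (simp add: us_def m_def nth_append)
  qed
  define P where "P = mat_of_cols n us"
  have P: "P \<in> carrier_mat n n" by (simp add: P_def len carrier_matI)
  have cols: "cols P = us" using us(1) CC by (simp add: P_def)
  have "rank P = n"
    using lin_indpt_full_rank[OF P] us Ci by (simp add: cols)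
  then have "det P \<noteq> 0" using det_rank_iff[OF P] by simp
  then obtain Q where Q: "Q \<in> carrier_mat n n" "P * Q = 1\<^sub>m n" "Q * P = 1\<^sub>m n"
    using det_non_zero_imp_unit[OF P, of "()"] by (auto simp: Units_def ring_mat_def)
  have QP: "Q *\<^sub>v (P *\<^sub>v x) = x" and PQ: "P *\<^sub>v (Q *\<^sub>v x) = x" if "x \<in> carrier_vec n" for x
    using that P Q by (simp_all flip: assoc_mult_mat_vec)
  have lincomb_C: "lincomb a C = lincomb a B" if "\<And>u. u \<in> C - B \<Longrightarrow> a u = 0" for a
  proof (rule eq_vecI)
    fix i assume "i < dim_vec (lincomb a B)"
    then have i: "i < n" using lincomb_dim[OF B(1)] BW WC by auto
    show "lincomb a C $ i = lincomb a B $ i"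
      using that i CC CB C(1)
      by (simp add: lincomb_index subset_trans[OF BW WC]) (rule sum.mono_neutral_right, auto)
  qed (simp add: lincomb_dim[OF B(1) subset_trans[OF BW WC]] lincomb_dim[OF C(1) CC])
  have iff: "v \<in> W \<longleftrightarrow> (\<forall>i. m \<le> i \<and> i < n \<longrightarrow> (Q *\<^sub>v v) $ i = 0)" if v: "v \<in> carrier_vec n" for v
  proof
    assume "v \<in> W"
    then obtain a where a: "v = lincomb a B"
      using spanB finite_in_span[OF B(1), of v] BW WC by auto
    define b where "b u = (if u \<in> B then a u else 0)" for u
    have "lincomb b C = lincomb b B" by (rule lincomb_C) (simp add: b_def)
    also have "\<dots> = v" unfolding a
      by (rule lincomb_cong) (use BW WC in \<open>auto simp: b_def\<close>)
    finally have "P *\<^sub>v vec n (\<lambda>i. b (col P i)) = v"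
      using mat_mult_eq_lincomb[OF P, of b] us by (simp add: cols)
    then have "Q *\<^sub>v v = vec n (\<lambda>i. b (col P i))" using QP by fastforce
    moreover have "col P i = us ! i" if "i < n" for i
      using that cols_nth[of i P] P by (simp add: cols)
    ultimately show "\<forall>i. m \<le> i \<and> i < n \<longrightarrow> (Q *\<^sub>v v) $ i = 0"
      using us_B by (auto simp: b_def)
  next
    assume zero: "\<forall>i. m \<le> i \<and> i < n \<longrightarrow> (Q *\<^sub>v v) $ i = 0"
    define a where "a u = (Q *\<^sub>v v) $ find_first u us" for u
    have "v = P *\<^sub>v (Q *\<^sub>v v)" using PQ v by simp
    also have "\<dots> = lincomb a C"
      unfolding a_def using lincomb_eq_mat_mult[OF P, of "Q *\<^sub>v v"] Q v us by (simp add: cols)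
    also have "\<dots> = lincomb a B"
    proof (rule lincomb_C)
      fix u assume u: "u \<in> C - B"
      then obtain i where i: "i < n" "u = us ! i" using us(1) len by (metis DiffD1 in_set_conv_nth)
      then show "a u = 0"
        using u us_B zero find_first_unique[OF us(2), of i] len by (simp add: a_def)
    qed
    also have "\<dots> \<in> span B" using B(1) BW WC by (auto simp: finite_span)
    also have "span B \<subseteq> W" by (rule span_is_subset[OF BW Wsub])
    finally show "v \<in> W" .
  qed
  have "m \<le> n" using len by (simp add: us_def m_def)
  then show thesis using that P Q iff by blast
qed

section \<open>Representations and composition series\<close>

lemma is_repD:
  assumes "is_rep A \<rho>"
  shows "f \<in> alg A \<Longrightarrow> \<rho> f \<in> carrier_mat (rep_dim \<rho>) (rep_dim \<rho>)"
    and "f \<in> alg A \<Longrightarrow> g \<in> alg A \<Longrightarrow> \<rho> (\<lambda>x. f x + g x) = \<rho> f + \<rho> g"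
    and "f \<in> alg A \<Longrightarrow> \<rho> (\<lambda>x. c * f x) = c \<cdot>\<^sub>m \<rho> f"
    and "f \<in> alg A \<Longrightarrow> g \<in> alg A \<Longrightarrow> \<rho> (conv f g) = \<rho> f * \<rho> g"
  using assms unfolding is_rep_def by blast+

lemma zero_in_alg [simp]: "(\<lambda>_. 0) \<in> alg A"
  and single_in_alg: "s \<in> A \<Longrightarrow> single s \<in> alg A"
  by (auto simp: alg_def single_def)

text \<open>A representation is determined by the images of the elements of \<open>A\<close>. The expansion is by
  entries, as an empty sum of matrices would have no definite size.\<close>
lemma rep_expand:
  fixes A :: "'a::{semigroup_mult, finite} set"
  assumes \<rho>: "is_rep A \<rho>" and f: "f \<in> alg A" and ij: "i < rep_dim \<rho>" "j < rep_dim \<rho>"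
  shows "\<rho> f $$ (i, j) = (\<Sum>s\<in>A. f s * \<rho> (single s) $$ (i, j))"
proof -
  note c = is_repD(1)[OF \<rho>]
  have "\<rho> (\<lambda>x. if x \<in> B then f x else 0) $$ (i, j) = (\<Sum>s\<in>B. f s * \<rho> (single s) $$ (i, j))"
    if "B \<subseteq> A" for B
    using finite[of B] that
  proof (induction B rule: finite_induct)
    case empty
    have "\<rho> (\<lambda>x. 0 * 0) = 0 \<cdot>\<^sub>m \<rho> (\<lambda>_. 0)" by (rule is_repD(3)[OF \<rho>]) simp
    then have "\<rho> (\<lambda>_. 0) $$ (i, j) = (0 \<cdot>\<^sub>m \<rho> (\<lambda>_. 0)) $$ (i, j)" by simp
    also have "\<dots> = 0" using c[of "\<lambda>_. 0"] ij by simp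
    finally show ?case by simp
  next
    case (insert s B)
    have s: "single s \<in> alg A" using insert by (simp add: single_in_alg)
    then have fs: "(\<lambda>x. f s * single s x) \<in> alg A" by (simp add: alg_def)
    have fB: "(\<lambda>x. if x \<in> B then f x else 0) \<in> alg A" using f by (simp add: alg_def)
    have eq: "(\<lambda>x. if x \<in> insert s B then f x else 0)
      = (\<lambda>x. f s * single s x + (if x \<in> B then f x else 0))"
      using insert by (auto simp: single_def)
    have "\<rho> (\<lambda>x. if x \<in> insert s B then f x else 0)
      = f s \<cdot>\<^sub>m \<rho> (single s) + \<rho> (\<lambda>x. if x \<in> B then f x else 0)"
      unfolding eq using is_repD(2)[OF \<rho> fs fB] is_repD(3)[OF \<rho> s] by simp
    then show ?case
      using insert ij c[OF s] c[OF fB] by simp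
  qed
  moreover have "(\<lambda>x. if x \<in> A then f x else 0) = f"
    using f by (auto simp: alg_def)
  ultimately show ?thesis by fastforce
qed

lemma conv_single: "conv (single s) (single t) = single (s * t)"
proof
  fix z
  have "conv (single s) (single t) z = (\<Sum>p | fst p * snd p = z. if p = (s, t) then 1 else 0)"
    unfolding conv_def by (rule sum.cong) (auto simp: single_def split: if_splits)
  also have "\<dots> = single (s * t) z" by (simp add: single_def)
  finally show "conv (single s) (single t) z = single (s * t) z" .
qed

lemma is_rep_conjugate:
  assumes \<sigma>: "is_rep A \<sigma>" "rep_dim \<sigma> = n"
    and P: "P \<in> carrier_mat n n" "Q \<in> carrier_mat n n" "P * Q = 1\<^sub>m n"
  shows "is_rep A (\<lambda>f. Q * \<sigma> f * P)"
proof -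
  have dim: "rep_dim (\<lambda>f. Q * \<sigma> f * P) = n" using P by (simp add: rep_dim_def)
  note c = is_repD(1)[OF \<sigma>(1), unfolded \<sigma>(2)]
  have mult: "Q * (\<sigma> f * \<sigma> g) * P = (Q * \<sigma> f * P) * (Q * \<sigma> g * P)" if "f \<in> alg A" "g \<in> alg A" for f g
  proof -
    have "(Q * \<sigma> f * P) * (Q * \<sigma> g * P) = Q * \<sigma> f * (P * (Q * (\<sigma> g * P)))"
      using P c[OF that(1)] c[OF that(2)] by (simp add: assoc_mult_mat[of _ n n _ n _ n])
    also have "P * (Q * (\<sigma> g * P)) = \<sigma> g * P"
      using P c[OF that(2)] by (subst assoc_mult_mat[symmetric, of P n n Q n]) auto
    finally show ?thesis using P c[OF that(1)] c[OF that(2)] by (simp add: assoc_mult_mat[of _ n n _ n _ n])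
  qed
  show ?thesis
    unfolding is_rep_def dim
  proof (intro conjI ballI allI)
    fix f g assume fg: "f \<in> alg A" "g \<in> alg A"
    note cf = c[OF fg(1)] and cg = c[OF fg(2)]
    show "Q * \<sigma> f * P \<in> carrier_mat n n" using P cf by auto
    show "Q * \<sigma> (\<lambda>x. f x + g x) * P = Q * \<sigma> f * P + Q * \<sigma> g * P"
      using P cf cg by (simp add: is_repD(2)[OF \<sigma>(1) fg] mult_add_distrib_mat[of _ n n]
        add_mult_distrib_mat[of _ n n])
    show "Q * \<sigma> (\<lambda>x. a * f x) * P = a \<cdot>\<^sub>m (Q * \<sigma> f * P)" for a
      using P cf by (simp add: is_repD(3)[OF \<sigma>(1) fg(1)] mult_smult_distrib[of _ n n _ n]
        mult_smult_assoc_mat[of _ n n _ n])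
    show "Q * \<sigma> (conv f g) * P = (Q * \<sigma> f * P) * (Q * \<sigma> g * P)"
      by (simp only: is_repD(4)[OF \<sigma>(1) fg] mult[OF fg])
  qed
qed

text \<open>The diagonal blocks are the representations on the invariant subspace and on the quotient by
  it.\<close>
lemma is_rep_block_triangular:
  assumes \<tau>: "is_rep A \<tau>" "rep_dim \<tau> = n" and m: "m \<le> n"
    and zero: "\<And>f i j. f \<in> alg A \<Longrightarrow> m \<le> i \<Longrightarrow> i < n \<Longrightarrow> j < m \<Longrightarrow> \<tau> f $$ (i, j) = 0"
  defines "\<tau>\<^sub>1 \<equiv> \<lambda>f. mat m m (\<lambda>(i, j). \<tau> f $$ (i, j))"
    and "\<tau>\<^sub>2 \<equiv> \<lambda>f. mat (n - m) (n - m) (\<lambda>(i, j). \<tau> f $$ (i + m, j + m))"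
  shows "is_rep A \<tau>\<^sub>1" "is_rep A \<tau>\<^sub>2"
    and "f \<in> alg A \<Longrightarrow> mat_trace (\<tau> f) = mat_trace (\<tau>\<^sub>1 f) + mat_trace (\<tau>\<^sub>2 f)"
proof -
  have dims: "rep_dim \<tau>\<^sub>1 = m" "rep_dim \<tau>\<^sub>2 = n - m"
    by (simp_all add: rep_dim_def \<tau>\<^sub>1_def \<tau>\<^sub>2_def)
  note c = is_repD(1)[OF \<tau>(1), unfolded \<tau>(2)]
  show "is_rep A \<tau>\<^sub>1"
    unfolding is_rep_def dims
  proof (intro conjI ballI allI)
    fix f g assume fg: "f \<in> alg A" "g \<in> alg A"
    show "\<tau>\<^sub>1 f \<in> carrier_mat m m" by (simp add: \<tau>\<^sub>1_def)
    show "\<tau>\<^sub>1 (\<lambda>x. f x + g x) = \<tau>\<^sub>1 f + \<tau>\<^sub>1 g"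
      using c[OF fg(1)] c[OF fg(2)] m
      by (intro eq_matI) (auto simp: \<tau>\<^sub>1_def is_repD(2)[OF \<tau>(1) fg])
    show "\<tau>\<^sub>1 (\<lambda>x. a * f x) = a \<cdot>\<^sub>m \<tau>\<^sub>1 f" for a
      using c[OF fg(1)] m by (intro eq_matI) (auto simp: \<tau>\<^sub>1_def is_repD(3)[OF \<tau>(1) fg(1)])
    show "\<tau>\<^sub>1 (conv f g) = \<tau>\<^sub>1 f * \<tau>\<^sub>1 g"
    proof (rule eq_matI)
      fix i j assume "i < dim_row (\<tau>\<^sub>1 f * \<tau>\<^sub>1 g)" "j < dim_col (\<tau>\<^sub>1 f * \<tau>\<^sub>1 g)"
      then have ij: "i < m" "j < m" by (simp_all add: \<tau>\<^sub>1_def)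
      have "\<tau>\<^sub>1 (conv f g) $$ (i, j) = (\<Sum>l<n. \<tau> f $$ (i, l) * \<tau> g $$ (l, j))"
        using ij m c[OF fg(1)] c[OF fg(2)]
        by (simp add: \<tau>\<^sub>1_def is_repD(4)[OF \<tau>(1) fg] mat_mult_entry[of _ n n _ n] del: index_mult_mat)
      also have "\<dots> = (\<Sum>l<m. \<tau> f $$ (i, l) * \<tau> g $$ (l, j))"
        using m ij zero[OF fg(2)] by (simp add: sum_lessThan_split[OF m])
      also have "\<dots> = (\<tau>\<^sub>1 f * \<tau>\<^sub>1 g) $$ (i, j)"
        using ij by (subst mat_mult_entry[of _ m m _ m]) (simp_all add: \<tau>\<^sub>1_def)
      finally show "\<tau>\<^sub>1 (conv f g) $$ (i, j) = (\<tau>\<^sub>1 f * \<tau>\<^sub>1 g) $$ (i, j)" .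
    qed (simp_all add: \<tau>\<^sub>1_def)
  qed
  show "is_rep A \<tau>\<^sub>2"
    unfolding is_rep_def dims
  proof (intro conjI ballI allI)
    fix f g assume fg: "f \<in> alg A" "g \<in> alg A"
    show "\<tau>\<^sub>2 f \<in> carrier_mat (n - m) (n - m)" by (simp add: \<tau>\<^sub>2_def)
    show "\<tau>\<^sub>2 (\<lambda>x. f x + g x) = \<tau>\<^sub>2 f + \<tau>\<^sub>2 g"
      using c[OF fg(1)] c[OF fg(2)]
      by (intro eq_matI) (auto simp: \<tau>\<^sub>2_def is_repD(2)[OF \<tau>(1) fg])
    show "\<tau>\<^sub>2 (\<lambda>x. a * f x) = a \<cdot>\<^sub>m \<tau>\<^sub>2 f" for a
      using c[OF fg(1)] by (intro eq_matI) (auto simp: \<tau>\<^sub>2_def is_repD(3)[OF \<tau>(1) fg(1)])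
    show "\<tau>\<^sub>2 (conv f g) = \<tau>\<^sub>2 f * \<tau>\<^sub>2 g"
    proof (rule eq_matI)
      fix i j assume "i < dim_row (\<tau>\<^sub>2 f * \<tau>\<^sub>2 g)" "j < dim_col (\<tau>\<^sub>2 f * \<tau>\<^sub>2 g)"
      then have ij: "i < n - m" "j < n - m" by (simp_all add: \<tau>\<^sub>2_def)
      have "\<tau>\<^sub>2 (conv f g) $$ (i, j) = (\<Sum>l<n. \<tau> f $$ (i + m, l) * \<tau> g $$ (l, j + m))"
        using ij c[OF fg(1)] c[OF fg(2)]
        by (simp add: \<tau>\<^sub>2_def is_repD(4)[OF \<tau>(1) fg] mat_mult_entry[of _ n n _ n] del: index_mult_mat)
      also have "\<dots> = (\<Sum>l<n - m. \<tau> f $$ (i + m, l + m) * \<tau> g $$ (l + m, j + m))"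
        using m ij zero[OF fg(1)] by (simp add: sum_lessThan_split[OF m])
      also have "\<dots> = (\<tau>\<^sub>2 f * \<tau>\<^sub>2 g) $$ (i, j)"
        using ij by (subst mat_mult_entry[of _ "n - m" "n - m" _ "n - m"]) (simp_all add: \<tau>\<^sub>2_def)
      finally show "\<tau>\<^sub>2 (conv f g) $$ (i, j) = (\<tau>\<^sub>2 f * \<tau>\<^sub>2 g) $$ (i, j)" .
    qed (simp_all add: \<tau>\<^sub>2_def)
  qed
  show "mat_trace (\<tau> f) = mat_trace (\<tau>\<^sub>1 f) + mat_trace (\<tau>\<^sub>2 f)" if "f \<in> alg A"
    using c[OF that] by (simp add: mat_trace_def \<tau>\<^sub>1_def \<tau>\<^sub>2_def sum_lessThan_split[OF m])
qed

text \<open>As the dimension decreases when passing to an invariant subspace and to its quotient, every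
  representation has a composition series, and its trace is the sum of those of the factors.
  Factors on which the algebra acts as zero contribute nothing and are left out.\<close>
lemma trace_composition_series:
  assumes "is_rep A \<sigma>"
  shows "\<exists>rs. (\<forall>\<rho>\<in>set rs. irreducible_rep A \<rho>) \<and>
    (\<forall>f\<in>alg A. mat_trace (\<sigma> f) = (\<Sum>\<rho>\<leftarrow>rs. mat_trace (\<rho> f)))"
  using assms
proof (induction "rep_dim \<sigma>" arbitrary: \<sigma> rule: less_induct)
  case less
  define n where "n = rep_dim \<sigma>"
  note c = is_repD(1)[OF less.prems, folded n_def]
  consider "irreducible_rep A \<sigma>" | "\<forall>f\<in>alg A. \<sigma> f = 0\<^sub>m n n"
    | W where "VectorSpace.subspace class_ring W (module_vec TYPE(complex) n)"
      "\<And>f v. f \<in> alg A \<Longrightarrow> v \<in> W \<Longrightarrow> \<sigma> f *\<^sub>v v \<in> W" "W \<noteq> {0\<^sub>v n}" "W \<noteq> carrier_vec n"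
    using less.prems unfolding irreducible_rep_def n_def by blast
  then show ?case
  proof cases
    case 1
    then show ?thesis by (intro exI[of _ "[\<sigma>]"]) simp
  next
    case 2
    then show ?thesis by (intro exI[of _ "[]"]) (simp add: mat_trace_def)
  next
    case 3
    obtain m P Q where m: "m \<le> n" and P: "P \<in> carrier_mat n n" and Q: "Q \<in> carrier_mat n n"
      and PQ: "P * Q = 1\<^sub>m n" and QP: "Q * P = 1\<^sub>m n"
      and W: "\<And>v. v \<in> carrier_vec n \<Longrightarrow> v \<in> W \<longleftrightarrow> (\<forall>i. m \<le> i \<and> i < n \<longrightarrow> (Q *\<^sub>v v) $ i = 0)"
      using adapted_basis[OF 3(1)] by metis
    note WC = subspaceD[OF 3(1)]
    have "m \<noteq> n" using W 3(4) WC(1) by auto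
    have "m \<noteq> 0"
    proof
      assume "m = 0"
      have "v = 0\<^sub>v n" if "v \<in> W" for v
      proof -
        have v: "v \<in> carrier_vec n" using that WC by auto
        have "Q *\<^sub>v v = 0\<^sub>v n" using W[OF v] that \<open>m = 0\<close> Q by (intro eq_vecI) auto
        then have "P *\<^sub>v (Q *\<^sub>v v) = 0\<^sub>v n" using P by auto
        then show ?thesis using P Q v PQ by (simp flip: assoc_mult_mat_vec)
      qed
      then show False using 3(3) WC(2) by blast
    qed
    \<comment> \<open>In a basis adapted to \<open>W\<close> the representation is block triangular.\<close>
    define \<tau> where "\<tau> f = Q * \<sigma> f * P" for f
    have \<tau>: "is_rep A \<tau>" and dim: "rep_dim \<tau> = n"
      unfolding \<tau>_def using is_rep_conjugate[OF less.prems _ P Q PQ] Q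
      by (simp_all add: n_def rep_dim_def)
    have zero: "\<tau> f $$ (i, j) = 0" if f: "f \<in> alg A" and i: "m \<le> i" "i < n" and j: "j < m" for f i j
    proof -
      have e: "P *\<^sub>v unit_vec n j \<in> carrier_vec n" using P by auto
      have "Q *\<^sub>v (P *\<^sub>v unit_vec n j) = unit_vec n j"
        using P Q QP by (simp flip: assoc_mult_mat_vec)
      then have "P *\<^sub>v unit_vec n j \<in> W" using W[OF e] j by auto
      then have w: "\<sigma> f *\<^sub>v (P *\<^sub>v unit_vec n j) \<in> W" by (rule 3(2)[OF f])
      then have "(Q *\<^sub>v (\<sigma> f *\<^sub>v (P *\<^sub>v unit_vec n j))) $ i = 0"
        using W[of "\<sigma> f *\<^sub>v (P *\<^sub>v unit_vec n j)"] WC(1) i by blast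
      also have "Q *\<^sub>v (\<sigma> f *\<^sub>v (P *\<^sub>v unit_vec n j)) = \<tau> f *\<^sub>v unit_vec n j"
        using P Q c[OF f] by (simp add: \<tau>_def assoc_mult_mat_vec[of _ n n _ n])
      also have "(\<tau> f *\<^sub>v unit_vec n j) $ i = \<tau> f $$ (i, j)"
        using i j is_repD(1)[OF \<tau> f] by (intro mat_mult_unit_vec) (auto simp: dim)
      finally show ?thesis .
    qed
    note blocks = is_rep_block_triangular[OF \<tau> dim m zero]
    have "m < rep_dim \<sigma>" "n - m < rep_dim \<sigma>"
      using \<open>m \<noteq> 0\<close> \<open>m \<noteq> n\<close> m by (simp_all add: n_def)
    then obtain rs\<^sub>1 rs\<^sub>2 where rs: "\<forall>\<rho>\<in>set rs\<^sub>1. irreducible_rep A \<rho>" "\<forall>\<rho>\<in>set rs\<^sub>2. irreducible_rep A \<rho>"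
      "\<forall>f\<in>alg A. mat_trace (mat m m (\<lambda>(i, j). \<tau> f $$ (i, j))) = (\<Sum>\<rho>\<leftarrow>rs\<^sub>1. mat_trace (\<rho> f))"
      "\<forall>f\<in>alg A. mat_trace (mat (n - m) (n - m) (\<lambda>(i, j). \<tau> f $$ (i + m, j + m)))
        = (\<Sum>\<rho>\<leftarrow>rs\<^sub>2. mat_trace (\<rho> f))"
      using less.hyps[OF _ blocks(1)] less.hyps[OF _ blocks(2)] by (auto simp: rep_dim_def)
    have "mat_trace (\<sigma> f) = mat_trace (\<tau> f)" if "f \<in> alg A" for f
      unfolding \<tau>_def using mat_trace_conjugate[OF c[OF that] Q P PQ] by simp
    then show ?thesis
      using rs blocks(3) by (intro exI[of _ "rs\<^sub>1 @ rs\<^sub>2"]) auto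
  qed
qed

section \<open>Irreducible representations and Schur's lemma\<close>

lemma irreducible_is_rep: "irreducible_rep A \<rho> \<Longrightarrow> is_rep A \<rho>"
  by (simp add: irreducible_rep_def)

text \<open>In dimension \<open>0\<close> every matrix is the zero matrix.\<close>
lemma irreducible_dim_pos:
  assumes "irreducible_rep A \<rho>"
  shows "rep_dim \<rho> > 0"
proof -
  obtain f where "f \<in> alg A" "\<rho> f \<noteq> 0\<^sub>m (rep_dim \<rho>) (rep_dim \<rho>)"
    using assms by (auto simp: irreducible_rep_def)
  moreover have "\<rho> f \<in> carrier_mat (rep_dim \<rho>) (rep_dim \<rho>)"
    using assms calculation by (auto intro: is_repD irreducible_is_rep)
  ultimately show ?thesis by (metis eq_matI carrier_matD not_less0 index_zero_mat(2,3) neq0_conv)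
qed

lemma irreducibleD:
  assumes "irreducible_rep A \<rho>" and "VectorSpace.subspace class_ring W (module_vec TYPE(complex) (rep_dim \<rho>))"
    and "\<And>f v. f \<in> alg A \<Longrightarrow> v \<in> W \<Longrightarrow> \<rho> f *\<^sub>v v \<in> W"
  shows "W = {0\<^sub>v (rep_dim \<rho>)} \<or> W = carrier_vec (rep_dim \<rho>)"
  using assms unfolding irreducible_rep_def by blast

lemma equiv_rep_refl: "is_rep A \<rho> \<Longrightarrow> equiv_rep A \<rho> \<rho>"
  unfolding equiv_rep_def by (blast intro: similar_mat_wit_refl is_repD(1))

lemma equiv_rep_trace:
  assumes "equiv_rep A \<rho> \<sigma>" "f \<in> alg A"
  shows "mat_trace (\<rho> f) = mat_trace (\<sigma> f)"
proof -
  obtain P Q where "similar_mat_wit (\<rho> f) (\<sigma> f) P Q"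
    using assms unfolding equiv_rep_def by blast
  from similar_mat_witD[OF refl this] show ?thesis
    using mat_trace_conjugate by metis
qed

lemma complete_irrepsD:
  assumes "complete_irreps A X"
  shows "\<rho> \<in> X \<Longrightarrow> irreducible_rep A \<rho>"
    and "\<rho> \<in> X \<Longrightarrow> \<sigma> \<in> X \<Longrightarrow> equiv_rep A \<rho> \<sigma> \<Longrightarrow> \<rho> = \<sigma>"
    and "irreducible_rep A \<rho> \<Longrightarrow> \<exists>\<sigma>\<in>X. equiv_rep A \<rho> \<sigma>"
  using assms equiv_rep_refl[of A] irreducible_is_rep[of A]
  unfolding complete_irreps_def by (blast, metis, blast)

text \<open>Schur's lemma. Kernel and image of an intertwiner are invariant, so if it is not zero, its
  kernel is trivial and its image is everything.\<close>
lemma intertwiner_zero_or_invertible: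
  assumes \<rho>: "irreducible_rep A \<rho>" and \<sigma>: "irreducible_rep A \<sigma>"
    and T: "T \<in> carrier_mat (rep_dim \<rho>) (rep_dim \<sigma>)"
    and intertwines: "\<And>f. f \<in> alg A \<Longrightarrow> \<rho> f * T = T * \<sigma> f"
  shows "T = 0\<^sub>m (rep_dim \<rho>) (rep_dim \<sigma>) \<or>
    (\<exists>Q \<in> carrier_mat (rep_dim \<sigma>) (rep_dim \<rho>). T * Q = 1\<^sub>m (rep_dim \<rho>) \<and> Q * T = 1\<^sub>m (rep_dim \<sigma>))"
proof (rule disjCI)
  define m n where mn: "m = rep_dim \<rho>" "n = rep_dim \<sigma>"
  assume noninv: "\<not> (\<exists>Q \<in> carrier_mat (rep_dim \<sigma>) (rep_dim \<rho>). T * Q = 1\<^sub>m (rep_dim \<rho>) \<and> Q * T = 1\<^sub>m (rep_dim \<sigma>))"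
  note T' = T[folded mn] and irr = irreducibleD[OF \<rho>, folded mn] irreducibleD[OF \<sigma>, folded mn]
  have c\<rho>: "\<rho> f \<in> carrier_mat m m" and c\<sigma>: "\<sigma> f \<in> carrier_mat n n" if "f \<in> alg A" for f
    using is_repD(1)[OF irreducible_is_rep] \<rho> \<sigma> that by (auto simp: mn)
  have comm: "\<rho> f *\<^sub>v (T *\<^sub>v v) = T *\<^sub>v (\<sigma> f *\<^sub>v v)" if "f \<in> alg A" "v \<in> carrier_vec n" for f v
    using T' c\<rho>[OF that(1)] c\<sigma>[OF that(1)] that(2) intertwines[OF that(1)]
    by (simp flip: assoc_mult_mat_vec)
  let ?K = "{v \<in> carrier_vec n. T *\<^sub>v v = 0\<^sub>v m}"
  let ?I = "(\<lambda>v. T *\<^sub>v v) ` carrier_vec n"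
  have "VectorSpace.subspace class_ring ?K (module_vec TYPE(complex) n)"
    using T' by (intro subspaceI) (auto simp: mult_add_distrib_mat_vec[of _ m n] mult_mat_vec[of _ m n])
  moreover have "\<sigma> f *\<^sub>v v \<in> ?K" if "f \<in> alg A" "v \<in> ?K" for f v
  proof -
    have "T *\<^sub>v (\<sigma> f *\<^sub>v v) = \<rho> f *\<^sub>v 0\<^sub>v m" using that comm[of f v] by simp
    also have "\<dots> = 0\<^sub>v m" using c\<rho>[OF that(1)] by auto
    finally show ?thesis using that c\<sigma>[OF that(1)] by auto
  qed
  ultimately consider "?K = {0\<^sub>v n}" | "?K = carrier_vec n"
    using irr(2)[of ?K] by blast
  then show "T = 0\<^sub>m (rep_dim \<rho>) (rep_dim \<sigma>)"
  proof cases
    case 1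
    have "VectorSpace.subspace class_ring ?I (module_vec TYPE(complex) m)"
    proof (rule subspaceI)
      show "?I \<subseteq> carrier_vec m" using T' by auto
      show "0\<^sub>v m \<in> ?I" using T' by (intro image_eqI[of _ _ "0\<^sub>v n"]) auto
      show "v + w \<in> ?I" if "v \<in> ?I" "w \<in> ?I" for v w
        using that T' by (auto simp flip: mult_add_distrib_mat_vec[of _ m n])
      show "c \<cdot>\<^sub>v v \<in> ?I" if "v \<in> ?I" for c v
        using that T' by (auto simp flip: mult_mat_vec[of _ m n])
    qed
    moreover have "\<rho> f *\<^sub>v v \<in> ?I" if "f \<in> alg A" "v \<in> ?I" for f v
      using that comm[of f] c\<sigma>[of f] by auto
    ultimately consider "?I = {0\<^sub>v m}" | "?I = carrier_vec m"
      using irr(1)[of ?I] by blast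
    then show ?thesis
    proof cases
      assume I: "?I = {0\<^sub>v m}"
      have "T *\<^sub>v v = 0\<^sub>m m n *\<^sub>v v" if "v \<in> carrier_vec n" for v
        using that I by (subst zero_mat_mult_vec) blast+
      then show ?thesis using T' unfolding mn[symmetric]
        by (intro eq_matI_mult_vec[of _ m n]) simp_all
    next
      assume I: "?I = carrier_vec m"
      have "\<forall>j. \<exists>v. v \<in> carrier_vec n \<and> T *\<^sub>v v = unit_vec m j"
        using I by (metis imageE unit_vec_carrier)
      then obtain q where q: "\<And>j. q j \<in> carrier_vec n" "\<And>j. T *\<^sub>v q j = unit_vec m j"
        by metis
      \<comment> \<open>The columns of \<open>Q\<close> are preimages of the unit vectors, which makes it a right inverse;
        by injectivity of \<open>T\<close> it is also a left inverse.\<close>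
      define Q where "Q = mat n m (\<lambda>(i, j). q j $ i)"
      have Q: "Q \<in> carrier_mat n m" by (simp add: Q_def)
      have TQ: "T * Q = 1\<^sub>m m"
      proof (rule eq_matI)
        fix i j assume "i < dim_row (1\<^sub>m m)" "j < dim_col (1\<^sub>m m)"
        then have ij: "i < m" "j < m" by auto
        have "(T * Q) $$ (i, j) = (\<Sum>l<n. T $$ (i, l) * q j $ l)"
          using T' Q ij by (subst mat_mult_entry) (auto simp: Q_def)
        also have "\<dots> = (T *\<^sub>v q j) $ i" using mult_mat_vec_entry[OF T' q(1) ij(1)] by simp
        finally show "(T * Q) $$ (i, j) = 1\<^sub>m m $$ (i, j)" using ij by (simp add: q)
      qed (use T' Q in auto)
      have "Q * T = 1\<^sub>m n"
      proof (rule eq_matI_mult_vec)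
        fix v :: "complex vec" assume v: "v \<in> carrier_vec n"
        let ?w = "Q *\<^sub>v (T *\<^sub>v v)"
        have w: "?w \<in> carrier_vec n" using Q T' v by auto
        have "T *\<^sub>v ?w = (T * Q) *\<^sub>v (T *\<^sub>v v)"
          using Q T' v by (intro assoc_mult_mat_vec[symmetric]) auto
        then have "T *\<^sub>v ?w = T *\<^sub>v v" using TQ T' v by auto
        then have "?w - v \<in> ?K"
          using T' v w by (auto simp: mult_minus_distrib_mat_vec[of _ m n])
        then have "?w - v = 0\<^sub>v n" using 1 by blast
        then have "(?w - v) $ i = 0" if "i < n" for i using that by simp
        then have "?w = v" using w v Q
          by (intro eq_vecI) (auto simp del: index_mult_mat_vec)
        then show "(Q * T) *\<^sub>v v = 1\<^sub>m n *\<^sub>v v" using Q T' v by auto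
      qed (use Q T' in auto)
      with TQ Q noninv show ?thesis by (auto simp: mn)
    qed
  next
    case 2
    then have "T *\<^sub>v v = 0\<^sub>m m n *\<^sub>v v" if "v \<in> carrier_vec n" for v
      using that by (subst zero_mat_mult_vec) blast+
    then show ?thesis using T' unfolding mn[symmetric]
      by (intro eq_matI_mult_vec[of _ m n]) simp_all
  qed
qed

lemma intertwiner_zero:
  assumes \<rho>: "irreducible_rep A \<rho>" and \<sigma>: "irreducible_rep A \<sigma>" and ne: "\<not> equiv_rep A \<rho> \<sigma>"
    and T: "T \<in> carrier_mat (rep_dim \<rho>) (rep_dim \<sigma>)"
    and intertwines: "\<And>f. f \<in> alg A \<Longrightarrow> \<rho> f * T = T * \<sigma> f"
  shows "T = 0\<^sub>m (rep_dim \<rho>) (rep_dim \<sigma>)"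
proof (rule ccontr)
  define m n where mn: "m = rep_dim \<rho>" "n = rep_dim \<sigma>"
  note T' = T[folded mn]
  assume "T \<noteq> 0\<^sub>m (rep_dim \<rho>) (rep_dim \<sigma>)"
  then obtain Q where Q: "Q \<in> carrier_mat n m" "T * Q = 1\<^sub>m m" "Q * T = 1\<^sub>m n"
    using intertwiner_zero_or_invertible[OF \<rho> \<sigma> T intertwines] by (auto simp: mn)
  have c\<rho>: "\<rho> f \<in> carrier_mat m m" and c\<sigma>: "\<sigma> f \<in> carrier_mat n n" if "f \<in> alg A" for f
    using is_repD(1)[OF irreducible_is_rep] \<rho> \<sigma> that by (auto simp: mn)
  \<comment> \<open>Taking traces of the two identity matrices shows that the dimensions agree.\<close>
  have "mat_trace (T * Q) = mat_trace (Q * T)" using T' Q by (intro mat_trace_mult_comm)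
  then have "(of_nat m :: complex) = of_nat n" by (simp add: Q mat_trace_def)
  then have [simp]: "n = m" by simp
  have "similar_mat_wit (\<rho> f) (\<sigma> f) T Q" if f: "f \<in> alg A" for f
  proof (rule similar_mat_witI[of _ _ m])
    have "T * \<sigma> f * Q = \<rho> f * (T * Q)"
      using T' Q c\<rho>[OF f] c\<sigma>[OF f] by (simp flip: intertwines[OF f] add: assoc_mult_mat[of _ m m _ m])
    then show "\<rho> f = T * \<sigma> f * Q" using c\<rho>[OF f] Q by simp
  qed (use T' Q c\<rho>[OF f] c\<sigma>[OF f] in auto)
  then show False using ne unfolding equiv_rep_def by blast
qed

text \<open>Subtracting an eigenvalue from \<open>T\<close> leaves an intertwiner that is not injective, hence
  zero.\<close>
lemma intertwiner_scalar:
  assumes \<rho>: "irreducible_rep A \<rho>"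
    and T: "T \<in> carrier_mat (rep_dim \<rho>) (rep_dim \<rho>)"
    and intertwines: "\<And>f. f \<in> alg A \<Longrightarrow> \<rho> f * T = T * \<rho> f"
  obtains c where "T = c \<cdot>\<^sub>m 1\<^sub>m (rep_dim \<rho>)"
proof -
  define n where "n = rep_dim \<rho>"
  note T' = T[folded n_def]
  have c\<rho>: "\<rho> f \<in> carrier_mat n n" if "f \<in> alg A" for f
    using is_repD(1)[OF irreducible_is_rep[OF \<rho>]] that by (auto simp: n_def)
  obtain c where "eigenvalue T c"
    using spectrum_non_empty[OF T'] irreducible_dim_pos[OF \<rho>] by (auto simp: spectrum_def n_def)
  then obtain v where v: "v \<in> carrier_vec n" "v \<noteq> 0\<^sub>v n" "T *\<^sub>v v = c \<cdot>\<^sub>v v"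
    using T' by (auto simp: eigenvalue_def eigenvector_def)
  let ?U = "T - c \<cdot>\<^sub>m 1\<^sub>m n"
  have U: "?U \<in> carrier_mat n n" using T' by auto
  have Uv: "?U *\<^sub>v v = 0\<^sub>v n"
    using T' v by (simp add: minus_mult_distrib_mat_vec[of _ n n] smult_mat_mult_vec[of _ n n])
  have "\<rho> f * ?U = ?U * \<rho> f" if f: "f \<in> alg A" for f
    using T' c\<rho>[OF f] intertwines[OF f]
    by (simp add: mult_minus_distrib_mat[of _ n n] minus_mult_distrib_mat[of _ n n]
      mult_smult_distrib[of "\<rho> f" n n "1\<^sub>m n" n] mult_smult_assoc_mat[of "1\<^sub>m n" n n _ n])
  then consider "?U = 0\<^sub>m n n" | Q where "Q \<in> carrier_mat n n" "Q * ?U = 1\<^sub>m n"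
    using intertwiner_zero_or_invertible[OF \<rho> \<rho>, of ?U] U by (auto simp: n_def)
  then show thesis
  proof cases
    case 1
    have "T = c \<cdot>\<^sub>m 1\<^sub>m n"
    proof (rule eq_matI)
      fix i j assume "i < dim_row (c \<cdot>\<^sub>m 1\<^sub>m n :: complex mat)" "j < dim_col (c \<cdot>\<^sub>m 1\<^sub>m n :: complex mat)"
      then show "T $$ (i, j) = (c \<cdot>\<^sub>m 1\<^sub>m n) $$ (i, j)"
        using arg_cong[OF 1, of "\<lambda>M. M $$ (i, j)"] T' by simp
    qed (use T' in auto)
    then show thesis using that by (simp add: n_def)
  next
    case 2
    have "v = (Q * ?U) *\<^sub>v v" using 2 v by simp
    also have "\<dots> = Q *\<^sub>v (?U *\<^sub>v v)" using 2 U v by (intro assoc_mult_mat_vec)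
    also have "\<dots> = 0\<^sub>v n" unfolding Uv using 2(1) by auto
    finally show thesis using v by simp
  qed
qed

section \<open>Orthogonality relations in a maximal subgroup\<close>

locale maximal_subgroup =
  fixes e :: "'a::{inverse_semigroup, finite}" and G :: "'a set"
  assumes idem: "e * e = e"
  defines "G \<equiv> max_subgroup e"
begin

lemma in_G_iff: "g \<in> G \<longleftrightarrow> sdom g = e \<and> sran g = e"
  by (simp add: G_def max_subgroup_def)

lemma G_inverse [simp]: "g \<in> G \<Longrightarrow> sinv g * g = e" "g \<in> G \<Longrightarrow> g * sinv g = e"
  by (simp_all add: in_G_iff sdom_def sran_def)

lemma G_unit [simp]: "g \<in> G \<Longrightarrow> e * g = g" "g \<in> G \<Longrightarrow> g * e = g"
  unfolding in_G_iff using sran_mult[of g] mult_sdom[of g] by (elim conjE, simp only:)+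

lemma G_cancel [simp]:
  assumes "g \<in> G" "h \<in> G"
  shows "sinv g * (g * h) = h" "g * (sinv g * h) = h" "h * g * sinv g = h" "h * sinv g * g = h"
proof -
  show "sinv g * (g * h) = h" "g * (sinv g * h) = h"
    using assms by (simp_all flip: mult.assoc)
  show "h * g * sinv g = h" "h * sinv g * g = h"
    using assms by (simp_all add: mult.assoc)
qed

lemma G_closed [simp, intro]:
  "e \<in> G" "g \<in> G \<Longrightarrow> sinv g \<in> G" "g \<in> G \<Longrightarrow> h \<in> G \<Longrightarrow> g * h \<in> G"
proof -
  show "e \<in> G" "g \<in> G \<Longrightarrow> sinv g \<in> G"
    unfolding in_G_iff using sdom_of_idempotent[OF idem] sran_of_idempotent[OF idem]
    by (simp_all only: sdom_sinv sran_sinv conj_commute)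
  show "g * h \<in> G" if "g \<in> G" "h \<in> G"
    using that composable[of g h] unfolding in_G_iff by (elim conjE) (simp only:)
qed

lemma card_G_pos: "card G > 0"
  using G_closed(1) by (auto simp: card_gt_0_iff)

lemma G_translate_bij:
  assumes "h \<in> G"
  shows "bij_betw (\<lambda>g. h * g) G G"
  using assms by (intro bij_betw_byWitness[of _ "\<lambda>g. sinv h * g"]) auto

lemma rep_single_mult:
  assumes "is_rep G \<rho>" "g \<in> G" "h \<in> G"
  shows "\<rho> (single (g * h)) = \<rho> (single g) * \<rho> (single h)"
  using is_repD(4)[OF assms(1)] assms(2,3) by (simp add: single_in_alg flip: conv_single)

lemma conv_unit:
  assumes "f \<in> alg G"
  shows "conv (single e) f = f"
proof
  fix z
  have "conv (single e) f z = (\<Sum>p | fst p * snd p = z. if fst p = e then f (snd p) else 0)"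
    unfolding conv_def by (rule sum.cong) (auto simp: single_def)
  also have "\<dots> = (\<Sum>p | fst p = e \<and> e * snd p = z. f (snd p))"
    by (rule sum.mono_neutral_cong_right) auto
  also have "\<dots> = (\<Sum>y | e * y = z. f y)"
    by (rule sum.reindex_bij_witness[where j = snd and i = "\<lambda>y. (e, y)"]) auto
  also have "\<dots> = (\<Sum>y\<in>UNIV. if y = z then f y else 0)"
  proof (rule sum.mono_neutral_cong_left)
    have zero: "f y = 0" if "e * y \<noteq> y" for y
      using that assms G_unit(1)[of y] unfolding alg_def by blast
    then show "\<forall>y\<in>UNIV - {y. e * y = z}. (if y = z then f y else 0) = 0" by simp
    show "f y = (if y = z then f y else 0)" if "y \<in> {y. e * y = z}" for y
      using zero[of y] that by simp
  qed simp_all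
  finally show "conv (single e) f z = f z" by simp
qed

text \<open>A representation need not preserve the identity, but the vectors fixed by the image of the
  identity form an invariant subspace, which is not zero as it contains the image of every
  \<open>\<rho> f\<close>.\<close>
lemma irreducible_unit:
  assumes \<rho>: "irreducible_rep G \<rho>"
  shows "\<rho> (single e) = 1\<^sub>m (rep_dim \<rho>)"
proof -
  define n where "n = rep_dim \<rho>"
  define M where "M = \<rho> (single e)"
  note rep = irreducible_is_rep[OF \<rho>]
  note c = is_repD(1)[OF rep, folded n_def]
  have M: "M \<in> carrier_mat n n" using c by (simp add: M_def single_in_alg)
  let ?W = "{v \<in> carrier_vec n. M *\<^sub>v v = v}"
  have closed: "\<rho> f *\<^sub>v v \<in> ?W" if f: "f \<in> alg G" and v: "v \<in> carrier_vec n" for f v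
  proof -
    have "M * \<rho> f = \<rho> f"
      using is_repD(4)[OF rep _ f, of "single e"] by (simp add: M_def conv_unit f single_in_alg)
    then have "M *\<^sub>v (\<rho> f *\<^sub>v v) = \<rho> f *\<^sub>v v"
      using M c[OF f] v by (simp flip: assoc_mult_mat_vec)
    then show ?thesis using c[OF f] v by auto
  qed
  have "VectorSpace.subspace class_ring ?W (module_vec TYPE(complex) n)"
    using M by (intro subspaceI) (auto simp: mult_add_distrib_mat_vec[of _ n n] mult_mat_vec[of _ n n])
  then consider "?W = {0\<^sub>v n}" | "?W = carrier_vec n"
    using irreducibleD[OF \<rho>, folded n_def, of ?W] closed by blast
  then show ?thesis
  proof cases
    case 1
    have "\<rho> f = 0\<^sub>m n n" if f: "f \<in> alg G" for f
    proof (rule eq_matI_mult_vec[OF c[OF f]])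
      fix v :: "complex vec" assume v: "v \<in> carrier_vec n"
      show "\<rho> f *\<^sub>v v = 0\<^sub>m n n *\<^sub>v v"
        using closed[OF f v] v unfolding 1 by (simp add: zero_mat_mult_vec)
    qed simp
    then show ?thesis using \<rho> by (auto simp: irreducible_rep_def n_def)
  next
    case 2
    have "M = 1\<^sub>m n"
    proof (rule eq_matI_mult_vec[OF M])
      fix v :: "complex vec" assume v: "v \<in> carrier_vec n"
      then have "v \<in> ?W" unfolding 2 .
      then show "M *\<^sub>v v = 1\<^sub>m n *\<^sub>v v" by simp
    qed simp
    then show ?thesis by (simp add: M_def n_def)
  qed
qed

text \<open>The average over the group of the matrix unit at \<open>(i, j)\<close>, that is
  \<open>\<Sum>\<^sub>g \<rho>(g) E\<^sub>i\<^sub>j \<sigma>(g\<^sup>-\<^sup>1)\<close>.\<close>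
definition averaged_unit :: "'a rep \<Rightarrow> 'a rep \<Rightarrow> nat \<Rightarrow> nat \<Rightarrow> complex mat" where
  "averaged_unit \<rho> \<sigma> i j = mat (rep_dim \<rho>) (rep_dim \<sigma>)
     (\<lambda>(a, b). \<Sum>g\<in>G. \<rho> (single g) $$ (a, i) * \<sigma> (single (sinv g)) $$ (j, b))"

lemma averaged_unit_carrier: "averaged_unit \<rho> \<sigma> i j \<in> carrier_mat (rep_dim \<rho>) (rep_dim \<sigma>)"
  by (simp add: averaged_unit_def)

text \<open>Replacing the summation variable \<open>g\<close> by \<open>hg\<close> moves \<open>h\<close> from the left to the
  right.\<close>
lemma averaged_unit_intertwines:
  assumes \<rho>: "is_rep G \<rho>" and \<sigma>: "is_rep G \<sigma>" and ij: "i < rep_dim \<rho>" "j < rep_dim \<sigma>"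
    and f: "f \<in> alg G"
  shows "\<rho> f * averaged_unit \<rho> \<sigma> i j = averaged_unit \<rho> \<sigma> i j * \<sigma> f"
proof -
  define m n where mn: "m = rep_dim \<rho>" "n = rep_dim \<sigma>"
  define T where "T = averaged_unit \<rho> \<sigma> i j"
  have T: "T \<in> carrier_mat m n" by (simp add: T_def averaged_unit_def mn)
  have T_entry: "T $$ (a, b) = (\<Sum>g\<in>G. \<rho> (single g) $$ (a, i) * \<sigma> (single (sinv g)) $$ (j, b))"
    if "a < m" "b < n" for a b
    using that by (simp add: T_def averaged_unit_def mn)
  note c\<rho> = is_repD(1)[OF \<rho>, folded mn] and c\<sigma> = is_repD(1)[OF \<sigma>, folded mn]
  have single: "(\<Sum>c<m. \<rho> (single h) $$ (a, c) * T $$ (c, b)) = (\<Sum>c<n. T $$ (a, c) * \<sigma> (single h) $$ (c, b))"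
    if h: "h \<in> G" and ab: "a < m" "b < n" for h a b
  proof -
    have "(\<Sum>c<m. \<rho> (single h) $$ (a, c) * T $$ (c, b)) =
      (\<Sum>c<m. \<Sum>g\<in>G. \<rho> (single h) $$ (a, c) * \<rho> (single g) $$ (c, i) * \<sigma> (single (sinv g)) $$ (j, b))"
      using ab by (simp add: T_entry sum_distrib_left mult.assoc)
    also have "\<dots> = (\<Sum>g\<in>G. (\<Sum>c<m. \<rho> (single h) $$ (a, c) * \<rho> (single g) $$ (c, i)) * \<sigma> (single (sinv g)) $$ (j, b))"
      by (subst sum.swap) (simp add: sum_distrib_right)
    also have "\<dots> = (\<Sum>g\<in>G. \<rho> (single (h * g)) $$ (a, i) * \<sigma> (single (sinv g)) $$ (j, b))"
    proof (rule sum.cong[OF refl])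
      fix g assume g: "g \<in> G"
      show "(\<Sum>c<m. \<rho> (single h) $$ (a, c) * \<rho> (single g) $$ (c, i)) * \<sigma> (single (sinv g)) $$ (j, b)
        = \<rho> (single (h * g)) $$ (a, i) * \<sigma> (single (sinv g)) $$ (j, b)"
        using rep_single_mult[OF \<rho> h g] ab ij
          mat_mult_entry[OF c\<rho>[OF single_in_alg[OF h]] c\<rho>[OF single_in_alg[OF g]], of a i]
        by (simp add: mn)
    qed
    also have "\<dots> = (\<Sum>g\<in>G. \<rho> (single (h * g)) $$ (a, i) * \<sigma> (single (sinv (h * g) * h)) $$ (j, b))"
      using h by (intro sum.cong) (simp_all add: sinv_mult)
    also have "\<dots> = (\<Sum>g\<in>G. \<rho> (single g) $$ (a, i) * \<sigma> (single (sinv g * h)) $$ (j, b))"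
      by (rule sum.reindex_bij_betw[OF G_translate_bij[OF h]])
    also have "\<dots> = (\<Sum>g\<in>G. \<rho> (single g) $$ (a, i) *
        (\<Sum>c<n. \<sigma> (single (sinv g)) $$ (j, c) * \<sigma> (single h) $$ (c, b)))"
    proof (rule sum.cong[OF refl])
      fix g assume "g \<in> G"
      then have g: "sinv g \<in> G" by simp
      show "\<rho> (single g) $$ (a, i) * \<sigma> (single (sinv g * h)) $$ (j, b) = \<rho> (single g) $$ (a, i) *
        (\<Sum>c<n. \<sigma> (single (sinv g)) $$ (j, c) * \<sigma> (single h) $$ (c, b))"
        using rep_single_mult[OF \<sigma> g h] ab ij
          mat_mult_entry[OF c\<sigma>[OF single_in_alg[OF g]] c\<sigma>[OF single_in_alg[OF h]], of j b]
        by (simp add: mn)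
    qed
    also have "\<dots> = (\<Sum>c<n. \<Sum>g\<in>G. \<rho> (single g) $$ (a, i) * \<sigma> (single (sinv g)) $$ (j, c) * \<sigma> (single h) $$ (c, b))"
      by (subst sum.swap) (simp add: sum_distrib_left mult.assoc)
    also have "\<dots> = (\<Sum>c<n. T $$ (a, c) * \<sigma> (single h) $$ (c, b))"
      using ab by (simp add: T_entry sum_distrib_right)
    finally show ?thesis .
  qed
  have "\<rho> f * T = T * \<sigma> f"
  proof (rule eq_matI)
    fix a b assume "a < dim_row (T * \<sigma> f)" "b < dim_col (T * \<sigma> f)"
    then have ab: "a < m" "b < n" using T c\<sigma>[OF f] by auto
    have "(\<rho> f * T) $$ (a, b) = (\<Sum>c<m. \<rho> f $$ (a, c) * T $$ (c, b))"
      by (rule mat_mult_entry[OF c\<rho>[OF f] T ab])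
    also have "\<dots> = (\<Sum>c<m. \<Sum>h\<in>G. f h * (\<rho> (single h) $$ (a, c) * T $$ (c, b)))"
      using ab by (simp add: rep_expand[OF \<rho> f] mn sum_distrib_right mult.assoc)
    also have "\<dots> = (\<Sum>h\<in>G. f h * (\<Sum>c<m. \<rho> (single h) $$ (a, c) * T $$ (c, b)))"
      by (subst sum.swap) (simp add: sum_distrib_left)
    also have "\<dots> = (\<Sum>h\<in>G. f h * (\<Sum>c<n. T $$ (a, c) * \<sigma> (single h) $$ (c, b)))"
      using single ab by simp
    also have "\<dots> = (\<Sum>c<n. \<Sum>h\<in>G. f h * (T $$ (a, c) * \<sigma> (single h) $$ (c, b)))"
      by (subst sum.swap) (simp add: sum_distrib_left)
    also have "\<dots> = (\<Sum>c<n. T $$ (a, c) * \<sigma> f $$ (c, b))"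
      using ab by (simp add: rep_expand[OF \<sigma> f] mn sum_distrib_left mult.left_commute)
    also have "\<dots> = (T * \<sigma> f) $$ (a, b)"
      by (rule mat_mult_entry[OF T c\<sigma>[OF f] ab, symmetric])
    finally show "(\<rho> f * T) $$ (a, b) = (T * \<sigma> f) $$ (a, b)" .
  qed (use T c\<rho>[OF f] c\<sigma>[OF f] in auto)
  then show ?thesis by (simp add: T_def)
qed

lemma schur_orthogonality_inequivalent:
  assumes \<rho>: "irreducible_rep G \<rho>" and \<sigma>: "irreducible_rep G \<sigma>" and ne: "\<not> equiv_rep G \<rho> \<sigma>"
    and "a < rep_dim \<rho>" "i < rep_dim \<rho>" "j < rep_dim \<sigma>" "b < rep_dim \<sigma>"
  shows "(\<Sum>g\<in>G. \<rho> (single g) $$ (a, i) * \<sigma> (single (sinv g)) $$ (j, b)) = 0"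
proof -
  have "averaged_unit \<rho> \<sigma> i j = 0\<^sub>m (rep_dim \<rho>) (rep_dim \<sigma>)"
    by (rule intertwiner_zero[OF \<rho> \<sigma> ne])
      (use assms in \<open>simp_all add: averaged_unit_intertwines irreducible_is_rep averaged_unit_carrier\<close>)
  from arg_cong[OF this, of "\<lambda>M. M $$ (a, b)"] show ?thesis
    using assms by (simp add: averaged_unit_def)
qed

text \<open>Here the average is a scalar multiple \<open>c\<close> of the identity, and its trace determines
  \<open>c\<close>, because \<open>\<rho>(g\<^sup>-\<^sup>1) \<rho>(g)\<close> is the identity matrix.\<close>
lemma schur_orthogonality:
  assumes \<rho>: "irreducible_rep G \<rho>"
    and "a < rep_dim \<rho>" "i < rep_dim \<rho>" "j < rep_dim \<rho>" "b < rep_dim \<rho>"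
  shows "(\<Sum>g\<in>G. \<rho> (single g) $$ (a, i) * \<rho> (single (sinv g)) $$ (j, b))
    = (if a = b \<and> i = j then of_nat (card G) / of_nat (rep_dim \<rho>) else 0)"
proof -
  define n where "n = rep_dim \<rho>"
  note ai = assms(2-)[folded n_def]
  note rep = irreducible_is_rep[OF \<rho>]
  note carr = is_repD(1)[OF rep, folded n_def]
  obtain c where c: "averaged_unit \<rho> \<rho> i j = c \<cdot>\<^sub>m 1\<^sub>m n"
    using intertwiner_scalar[OF \<rho> averaged_unit_carrier averaged_unit_intertwines[OF rep rep]] assms
    unfolding n_def by blast
  have entry: "(\<Sum>g\<in>G. \<rho> (single g) $$ (a, i) * \<rho> (single (sinv g)) $$ (j, b)) = (if a = b then c else 0)"
    if "a < n" "b < n" for a b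
    using that arg_cong[OF c, of "\<lambda>M. M $$ (a, b)"] by (simp add: averaged_unit_def n_def)
  have "of_nat n * c = (\<Sum>a<n. \<Sum>g\<in>G. \<rho> (single g) $$ (a, i) * \<rho> (single (sinv g)) $$ (j, a))"
    by (simp add: entry)
  also have "\<dots> = (\<Sum>g\<in>G. \<Sum>a<n. \<rho> (single (sinv g)) $$ (j, a) * \<rho> (single g) $$ (a, i))"
    by (subst sum.swap) (simp add: mult.commute)
  also have "\<dots> = (\<Sum>g\<in>G. \<rho> (single e) $$ (j, i))"
  proof (rule sum.cong[OF refl])
    fix g assume g: "g \<in> G"
    then have g': "sinv g \<in> G" by simp
    show "(\<Sum>a<n. \<rho> (single (sinv g)) $$ (j, a) * \<rho> (single g) $$ (a, i)) = \<rho> (single e) $$ (j, i)"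
      using rep_single_mult[OF rep g' g] g ai
        mat_mult_entry[OF carr[OF single_in_alg[OF g']] carr[OF single_in_alg[OF g]], of j i]
      by simp
  qed
  also have "\<dots> = (if i = j then of_nat (card G) else 0)"
    using ai by (auto simp: irreducible_unit[OF \<rho>] n_def)
  finally have "c = (if i = j then of_nat (card G) / of_nat n else 0)"
    using irreducible_dim_pos[OF \<rho>] by (auto simp: n_def field_simps)
  then show ?thesis using entry ai by (simp add: n_def)
qed

lemma character_orthogonality:
  assumes IRR: "complete_irreps G I" and \<rho>: "\<rho> \<in> I" and \<sigma>: "\<sigma> \<in> I"
  shows "(\<Sum>g\<in>G. mat_trace (\<rho> (single g)) * mat_trace (\<sigma> (single (sinv g))))
    = (if \<rho> = \<sigma> then of_nat (card G) else 0)"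
proof -
  note irr = complete_irrepsD(1)[OF IRR]
  note reps = irreducible_is_rep[OF irr[OF \<rho>]] irreducible_is_rep[OF irr[OF \<sigma>]]
  have tr: "mat_trace (\<rho>' (single g)) = (\<Sum>a<rep_dim \<rho>'. \<rho>' (single g) $$ (a, a))" if "g \<in> G" "is_rep G \<rho>'" for g \<rho>'
    using is_repD(1)[OF that(2) single_in_alg[OF that(1)]] by (simp add: mat_trace_def)
  have "(\<Sum>g\<in>G. mat_trace (\<rho> (single g)) * mat_trace (\<sigma> (single (sinv g)))) =
    (\<Sum>g\<in>G. \<Sum>a<rep_dim \<rho>. \<Sum>b<rep_dim \<sigma>. \<rho> (single g) $$ (a, a) * \<sigma> (single (sinv g)) $$ (b, b))"
    by (intro sum.cong) (simp_all add: tr reps sum_product)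
  also have "\<dots> = (\<Sum>a<rep_dim \<rho>. \<Sum>b<rep_dim \<sigma>. \<Sum>g\<in>G. \<rho> (single g) $$ (a, a) * \<sigma> (single (sinv g)) $$ (b, b))"
    by (subst sum.swap) (intro sum.cong refl sum.swap)
  also have "\<dots> = (if \<rho> = \<sigma> then of_nat (card G) else 0)"
  proof (cases "\<rho> = \<sigma>")
    case True
    then show ?thesis
      using irreducible_dim_pos[OF irr[OF \<sigma>]] by (simp add: schur_orthogonality[OF irr[OF \<sigma>]])
  next
    case False
    then have "\<not> equiv_rep G \<rho> \<sigma>" using complete_irrepsD(2)[OF IRR \<rho> \<sigma>] by blast
    then show ?thesis
      using False by (simp add: schur_orthogonality_inequivalent[OF irr[OF \<rho>] irr[OF \<sigma>]])
  qed
  finally show ?thesis .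
qed

lemma conv_quotient:
  assumes f: "f \<in> alg G" and g: "g \<in> alg G" and ab: "a \<in> G" "b \<in> G"
  shows "conv f g (a * sinv b) = (\<Sum>c\<in>G. f (a * sinv c) * g (c * sinv b))"
proof -
  have "conv f g (a * sinv b) = (\<Sum>(x, y) | x \<in> G \<and> y \<in> G \<and> x * y = a * sinv b. f x * g y)"
    unfolding conv_def using f g by (intro sum.mono_neutral_right) (auto simp: alg_def)
  also have "\<dots> = (\<Sum>c\<in>G. f (a * sinv c) * g (c * sinv b))"
  proof (rule sum.reindex_bij_witness[where j = "\<lambda>(x, y). y * b" and i = "\<lambda>c. (a * sinv c, c * sinv b)"])
    fix p assume p: "p \<in> {(x, y). x \<in> G \<and> y \<in> G \<and> x * y = a * sinv b}"
    obtain x y where [simp]: "p = (x, y)" by (cases p)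
    have xy: "x \<in> G" "y \<in> G" "x * y = a * sinv b" using p by auto
    have "a * sinv (y * b) = (x * y) * sinv y" using xy by (simp add: sinv_mult mult.assoc)
    then have "a * sinv (y * b) = x" using xy(1,2) by simp
    then show "(a * sinv (case p of (x, y) \<Rightarrow> y * b), (case p of (x, y) \<Rightarrow> y * b) * sinv b) = p"
      and "f (a * sinv (case p of (x, y) \<Rightarrow> y * b)) * g ((case p of (x, y) \<Rightarrow> y * b) * sinv b) = (case p of (x, y) \<Rightarrow> f x * g y)"
      using xy ab by simp_all
    show "(case p of (x, y) \<Rightarrow> y * b) \<in> G" using xy ab by simp
  next
    fix c assume c: "c \<in> G"
    have "a * sinv c * (c * sinv b) = (a * sinv c * c) * sinv b" by (simp only: mult.assoc)
    then show "(a * sinv c, c * sinv b) \<in> {(x, y). x \<in> G \<and> y \<in> G \<and> x * y = a * sinv b}"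
      using ab c by simp
    show "(case (a * sinv c, c * sinv b) of (x, y) \<Rightarrow> y * b) = c" using ab c by simp
  qed
  finally show ?thesis .
qed

text \<open>The irreducible constituents of the regular representation. In its matrix the entry at
  \<open>(i, j)\<close> is the coefficient of the element that takes \<open>x\<^sub>j\<close> to \<open>x\<^sub>i\<close>.\<close>
lemma regular_trace:
  obtains rs where "\<forall>\<rho>\<in>set rs. irreducible_rep G \<rho>"
    and "\<And>f. f \<in> alg G \<Longrightarrow> (\<Sum>\<rho>\<leftarrow>rs. mat_trace (\<rho> f)) = of_nat (card G) * f e"
proof -
  define N where "N = card G"
  obtain x where x: "bij_betw x {..<N} G"
    unfolding N_def using ex_bij_betw_nat_finite[OF finite[of G]] by (auto simp: atLeast0LessThan)
  have xG: "x i \<in> G" if "i < N" for i using x that by (auto simp: bij_betw_def)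
  define R :: "'a rep" where "R f = mat N N (\<lambda>(i, j). f (x i * sinv (x j)))" for f
  have dim: "rep_dim R = N" by (simp add: rep_dim_def R_def)
  have "is_rep G R"
    unfolding is_rep_def dim
  proof (intro conjI ballI allI)
    fix f g assume fg: "f \<in> alg G" "g \<in> alg G"
    show "R f \<in> carrier_mat N N" by (simp add: R_def)
    show "R (\<lambda>x. f x + g x) = R f + R g" by (intro eq_matI) (auto simp: R_def)
    show "R (\<lambda>x. c * f x) = c \<cdot>\<^sub>m R f" for c by (intro eq_matI) (auto simp: R_def)
    show "R (conv f g) = R f * R g"
    proof (rule eq_matI)
      fix i j assume "i < dim_row (R f * R g)" "j < dim_col (R f * R g)"
      then have ij: "i < N" "j < N" by (simp_all add: R_def)
      have "R (conv f g) $$ (i, j) = (\<Sum>c\<in>G. f (x i * sinv c) * g (c * sinv (x j)))"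
        using ij by (simp add: R_def conv_quotient[OF fg] xG)
      also have "\<dots> = (\<Sum>l<N. f (x i * sinv (x l)) * g (x l * sinv (x j)))"
        by (rule sum.reindex_bij_betw[OF x, symmetric])
      also have "\<dots> = (R f * R g) $$ (i, j)"
        using ij by (subst mat_mult_entry[of _ N N _ N]) (simp_all add: R_def)
      finally show "R (conv f g) $$ (i, j) = (R f * R g) $$ (i, j)" .
    qed (simp_all add: R_def)
  qed
  from trace_composition_series[OF this] obtain rs where "\<forall>\<rho>\<in>set rs. irreducible_rep G \<rho>"
    "\<forall>f\<in>alg G. mat_trace (R f) = (\<Sum>\<rho>\<leftarrow>rs. mat_trace (\<rho> f))" by blast
  moreover have "mat_trace (R f) = of_nat (card G) * f e" for f
    by (simp add: mat_trace_def R_def xG) (simp add: N_def)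
  ultimately show thesis using that by simp
qed

text \<open>Every constituent of the regular representation is replaced by its representative in
  \<open>I\<close>. Pairing the trace of the regular representation with the character of
  \<open>\<sigma> \<in> I\<close> gives \<open>|G| d\<^sub>\<sigma>\<close> if it is evaluated directly, and \<open>|G|\<close> times
  the multiplicity of \<open>\<sigma>\<close> by row orthogonality. Thus \<open>\<sigma>\<close> occurs \<open>d\<^sub>\<sigma>\<close>
  times, and in particular at least once.\<close>
theorem column_orthogonality:
  assumes I: "complete_irreps G I"
  shows "finite I"
    and "h \<in> G \<Longrightarrow> (\<Sum>\<rho>\<in>I. of_nat (rep_dim \<rho>) * mat_trace (\<rho> (single h))) = (if h = e then of_nat (card G) else 0)"
proof -
  obtain rs where irr: "\<forall>\<rho>\<in>set rs. irreducible_rep G \<rho>"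
    and reg: "\<And>f. f \<in> alg G \<Longrightarrow> (\<Sum>\<rho>\<leftarrow>rs. mat_trace (\<rho> f)) = of_nat (card G) * f e"
    by (rule regular_trace) blast
  define nf where "nf \<rho> = (SOME \<sigma>. \<sigma> \<in> I \<and> equiv_rep G \<rho> \<sigma>)" for \<rho>
  have nf: "nf \<rho> \<in> I" "equiv_rep G \<rho> (nf \<rho>)" if "\<rho> \<in> set rs" for \<rho>
  proof -
    from that irr have "\<exists>\<sigma>. \<sigma> \<in> I \<and> equiv_rep G \<rho> \<sigma>"
      using complete_irrepsD(3)[OF I] by blast
    from someI_ex[OF this] show "nf \<rho> \<in> I" "equiv_rep G \<rho> (nf \<rho>)"
      unfolding nf_def by blast+
  qed
  define S where "S = set (map nf rs)"
  define mult where "mult = count_list (map nf rs)"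
  have SI: "S \<subseteq> I" using nf by (auto simp: S_def)
  have "finite S" by (simp add: S_def)
  have reg: "(\<Sum>\<rho>\<in>S. of_nat (mult \<rho>) * mat_trace (\<rho> (single h))) = (if h = e then of_nat (card G) else 0)"
    if "h \<in> G" for h
  proof -
    have "(\<Sum>\<rho>\<in>S. of_nat (mult \<rho>) * mat_trace (\<rho> (single h))) = (\<Sum>\<rho>\<leftarrow>map nf rs. mat_trace (\<rho> (single h)))"
      unfolding mult_def by (rule sum_list_map_eq_sum_count_list[symmetric]) (simp_all add: S_def)
    also have "\<dots> = (\<Sum>\<rho>\<leftarrow>rs. mat_trace (\<rho> (single h)))"
      using equiv_rep_trace[OF nf(2) single_in_alg[OF that]]
      by (simp add: o_def cong: map_cong)
    also have "\<dots> = (if h = e then of_nat (card G) else 0)"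
      using reg[OF single_in_alg[OF that]] by (simp add: single_def)
    finally show ?thesis .
  qed
  have mult: "mult \<sigma> = rep_dim \<sigma>" if \<sigma>: "\<sigma> \<in> I" for \<sigma>
  proof -
    have "of_nat (card G) * of_nat (rep_dim \<sigma>) = (\<Sum>g\<in>G. (if g = e then of_nat (card G) else 0) * mat_trace (\<sigma> (single (sinv g))))"
      using irreducible_unit[OF complete_irrepsD(1)[OF I \<sigma>]]
      by (simp add: if_distrib[of "\<lambda>x. x * _"] sinv_idempotent idem mat_trace_def cong: if_cong)
    also have "\<dots> = (\<Sum>g\<in>G. \<Sum>\<rho>\<in>S. of_nat (mult \<rho>) * (mat_trace (\<rho> (single g)) * mat_trace (\<sigma> (single (sinv g)))))"
      by (intro sum.cong) (simp_all add: sum_distrib_right mult.assoc flip: reg)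
    also have "\<dots> = (\<Sum>\<rho>\<in>S. of_nat (mult \<rho>) * (\<Sum>g\<in>G. mat_trace (\<rho> (single g)) * mat_trace (\<sigma> (single (sinv g)))))"
      by (subst sum.swap) (simp add: sum_distrib_left)
    also have "\<dots> = (\<Sum>\<rho>\<in>S. if \<rho> = \<sigma> then of_nat (mult \<rho>) * of_nat (card G) else 0)"
      using SI by (intro sum.cong) (auto simp: character_orthogonality[OF I _ \<sigma>])
    also have "\<dots> = (if \<sigma> \<in> S then of_nat (mult \<sigma>) * of_nat (card G) else 0)"
      using \<open>finite S\<close> by simp
    also have "\<dots> = of_nat (card G) * of_nat (mult \<sigma>)"
      using count_notin[of \<sigma> "map nf rs"] by (simp add: S_def mult_def del: set_map)
    finally have "(of_nat (rep_dim \<sigma>) :: complex) = of_nat (mult \<sigma>)"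
      using card_G_pos by auto
    then show ?thesis by simp
  qed
  have "I \<subseteq> S"
  proof
    fix \<sigma> assume \<sigma>: "\<sigma> \<in> I"
    then have "mult \<sigma> \<noteq> 0"
      using mult irreducible_dim_pos complete_irrepsD(1)[OF I] by fastforce
    then show "\<sigma> \<in> S" unfolding S_def mult_def by (metis count_notin)
  qed
  with SI have [simp]: "S = I" by blast
  then show "finite I" using \<open>finite S\<close> by simp
  show "(\<Sum>\<rho>\<in>I. of_nat (rep_dim \<rho>) * mat_trace (\<rho> (single h))) = (if h = e then of_nat (card G) else 0)" if "h \<in> G"
    using reg[OF that] by (simp add: mult)
qed

end

section \<open>D-classes\<close>

lemma mem_D_class_iff_sran:
  assumes "C \<in> UNIV // D_rel"
  shows "s \<in> C \<longleftrightarrow> sran s \<in> C"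
  using assms by (auto simp: quotient_def D_rel_def sran_of_idempotent)

text \<open>If \<open>x\<close> connects \<open>ran z\<close> to \<open>ran t\<close>, then \<open>t\<^sup>-\<^sup>1 x\<close> connects it to
  \<open>dom t\<close>.\<close>
lemma mem_D_class_iff_sdom:
  assumes C: "C \<in> UNIV // D_rel"
  shows "s \<in> C \<longleftrightarrow> sdom s \<in> C"
proof -
  have inverse: "sinv t \<in> C" if t: "t \<in> C" for t :: 'a
  proof -
    obtain z where z: "C = D_rel `` {z}" using C by (auto simp: quotient_def)
    then obtain x where x: "sdom x = sran z" "sran x = sran t"
      using t by (auto simp: D_rel_def)
    then have "sdom (sinv t * x) = sran z" "sran (sinv t * x) = sran (sinv t)"
      using composable[of "sinv t" x] by simp_all
    then show ?thesis unfolding z by (auto simp: D_rel_def)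
  qed
  have "s \<in> C \<longleftrightarrow> sinv s \<in> C" using inverse[of s] inverse[of "sinv s"] by auto
  then show ?thesis using mem_D_class_iff_sran[OF C, of "sinv s"] by simp
qed

locale D_class =
  fixes C :: "'a::{inverse_semigroup, finite} set" and e :: 'a and p :: "'a \<Rightarrow> 'a" and ix :: "nat \<Rightarrow> 'a"
    and G :: "'a set" and r :: nat
  assumes C: "C \<in> UNIV // D_rel" and e: "e \<in> idempotents C"
    and p: "f \<in> idempotents C \<Longrightarrow> sdom (p f) = e \<and> sran (p f) = f"
    and ix: "bij_betw ix {..<card (idempotents C)} (idempotents C)"
  defines "G \<equiv> max_subgroup e" and "r \<equiv> card (idempotents C)"
begin

sublocale maximal_subgroup e G
  using e by unfold_locales (simp_all add: idempotents_def G_def)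

lemma C_sran [simp]: "sran s \<in> C \<longleftrightarrow> s \<in> C" and C_sdom [simp]: "sdom s \<in> C \<longleftrightarrow> s \<in> C"
  using mem_D_class_iff_sran[OF C] mem_D_class_iff_sdom[OF C] by blast+

lemma idem_sran [simp]: "sran s \<in> idempotents C \<longleftrightarrow> s \<in> C"
  and idem_sdom [simp]: "sdom s \<in> idempotents C \<longleftrightarrow> s \<in> C"
  by (simp_all add: idempotents_def)

text \<open>\<open>twist\<close> moves an element of the class to the maximal subgroup at \<open>e\<close> along the
  connecting elements \<open>p\<close>; \<open>untwist a b\<close> is its inverse on the elements with range
  \<open>a\<close> and domain \<open>b\<close>.\<close>
definition twist :: "'a \<Rightarrow> 'a" where
  "twist s = sinv (p (sran s)) * s * p (sdom s)"

definition untwist :: "'a \<Rightarrow> 'a \<Rightarrow> 'a \<Rightarrow> 'a" where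
  "untwist a b h = p a * h * sinv (p b)"

lemma twist_in_G:
  assumes "s \<in> C"
  shows "twist s \<in> G"
proof -
  have 1: "sdom (p (sran s)) = e" "sran (p (sran s)) = sran s" "sdom (p (sdom s)) = e" "sran (p (sdom s)) = sdom s"
    using p[of "sran s"] p[of "sdom s"] assms by auto
  have 2: "sdom (sinv (p (sran s)) * s) = sdom s" "sran (sinv (p (sran s)) * s) = e"
    using composable[of "sinv (p (sran s))" s] 1 by simp_all
  show ?thesis
    using composable[of "sinv (p (sran s)) * s" "p (sdom s)"] 1 2 unfolding twist_def in_G_iff by simp
qed

lemma twist_mult:
  assumes "s \<in> C" "sdom s = sran t"
  shows "twist (s * t) = twist s * twist t"
proof -
  have "twist s * twist t = sinv (p (sran s)) * s * sran (p (sdom s)) * t * p (sdom t)"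
    by (simp add: twist_def sran_def[of "p _"] assms(2) mult.assoc)
  also have "sinv (p (sran s)) * s * sran (p (sdom s)) = sinv (p (sran s)) * (s * sdom s)"
    using p[of "sdom s"] assms(1) by (simp add: mult.assoc)
  finally show ?thesis
    using composable[OF assms(2)] by (simp add: twist_def mult.assoc)
qed

lemma untwist:
  assumes a: "a \<in> idempotents C" and b: "b \<in> idempotents C" and h: "h \<in> G"
  shows "sran (untwist a b h) = a" "sdom (untwist a b h) = b" "twist (untwist a b h) = h"
proof -
  have h': "sran h = e" "sdom h = e" using h by (simp_all add: in_G_iff)
  have 1: "sran (p a * h) = a" "sdom (p a * h) = e"
    using composable[of "p a" h] p[OF a] h' by simp_all
  show 2: "sran (untwist a b h) = a" "sdom (untwist a b h) = b"
    using composable[of "p a * h" "sinv (p b)"] p[OF b] 1 by (simp_all add: untwist_def)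
  have "twist (untwist a b h) = sdom (p a) * h * sdom (p b)"
    unfolding twist_def 2 by (simp add: untwist_def sdom_def mult.assoc)
  then show "twist (untwist a b h) = h" using p[OF a] p[OF b] h by simp
qed

lemma untwist_twist:
  assumes "s \<in> C"
  shows "untwist (sran s) (sdom s) (twist s) = s"
proof -
  have "untwist (sran s) (sdom s) (twist s) = sran (p (sran s)) * s * sran (p (sdom s))"
    by (simp add: untwist_def twist_def sran_def[of "p _"] mult.assoc)
  then show ?thesis using p[of "sran s"] p[of "sdom s"] assms by simp
qed

lemma bij_betw_twist:
  assumes a: "a \<in> idempotents C" and b: "b \<in> idempotents C"
  shows "bij_betw twist {s. sran s = a \<and> sdom s = b} G"
proof (rule bij_betw_byWitness[where f' = "untwist a b"])
  have "s \<in> C" if "sran s = a" for s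
    using a that C_sran[of s] by (simp add: idempotents_def)
  then show "\<forall>s\<in>{s. sran s = a \<and> sdom s = b}. untwist a b (twist s) = s"
    and "twist ` {s. sran s = a \<and> sdom s = b} \<subseteq> G"
    using untwist_twist twist_in_G by blast+
  show "\<forall>h\<in>G. twist (untwist a b h) = h" "untwist a b ` G \<subseteq> {s. sran s = a \<and> sdom s = b}"
    using untwist[OF a b] by auto
qed

lemma twist_eq_unit:
  assumes "s \<in> C" "sran s = sdom s" "twist s = e"
  shows "s = sran s"
proof -
  have e': "e = twist (sran s)"
  proof -
    have "twist (sran s) = sinv (p (sran s)) * (sran (p (sran s)) * p (sran s))"
      using p[of "sran s"] assms(1)
      by (simp add: twist_def sran_of_idempotent sdom_of_idempotent mult.assoc del: sran_mult)
    also have "\<dots> = sdom (p (sran s))" by (simp add: sdom_def)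
    finally show ?thesis using p[of "sran s"] assms(1) by simp
  qed
  have "inj_on twist {t. sran t = sran s \<and> sdom t = sran s}"
    using bij_betw_twist[of "sran s" "sran s"] assms(1) by (simp add: bij_betw_def)
  from inj_onD[OF this trans[OF assms(3) e']] show ?thesis
    by (simp add: assms(2) sran_of_idempotent sdom_of_idempotent)
qed

lemma ix_idem: "i < r \<Longrightarrow> ix i \<in> idempotents C"
  using ix by (auto simp: bij_betw_def r_def)

lemma ix_eq_iff: "i < r \<Longrightarrow> j < r \<Longrightarrow> ix i = ix j \<longleftrightarrow> i = j"
  using ix by (auto simp: bij_betw_def r_def inj_on_def)

lemma ix_surj:
  assumes "a \<in> idempotents C"
  obtains i where "i < r" "ix i = a"
  using ix assms unfolding bij_betw_def r_def by (metis imageE lessThan_iff)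

lemma r_pos: "r > 0"
  using e by (auto simp: r_def card_gt_0_iff)

end

section \<open>Induced representations\<close>

locale induction_from_subgroup = D_class +
  fixes \<rho> :: "'a rep" and d :: nat and B :: "'a \<Rightarrow> complex mat" and \<rho>' :: "'a rep"
  assumes \<rho>: "irreducible_rep G \<rho>"
  defines "d \<equiv> rep_dim \<rho>" and "B \<equiv> induced_basis C ix p \<rho>" and "\<rho>' \<equiv> induced_rep C ix p \<rho>"
begin

lemma \<rho>_rep: "is_rep G \<rho>" by (rule irreducible_is_rep[OF \<rho>])

lemma \<rho>_carrier: "f \<in> alg G \<Longrightarrow> \<rho> f \<in> carrier_mat d d"
  using is_repD(1)[OF \<rho>_rep] by (simp add: d_def)

lemma d_pos: "d > 0" using irreducible_dim_pos[OF \<rho>] by (simp add: d_def)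

lemma div_less: "i < r * d \<Longrightarrow> i div d < r" and mod_less: "i mod d < d"
  using d_pos by (simp_all add: less_mult_imp_div_less)

lemma B_carrier: "B s \<in> carrier_mat (r * d) (r * d)"
proof (cases "s \<in> C")
  case True
  then have "\<rho> (single (twist s)) \<in> carrier_mat d d"
    by (intro \<rho>_carrier single_in_alg twist_in_G)
  then show ?thesis
    using True by (auto simp: B_def induced_basis_def Let_def kronecker_def matrix_unit_def r_def twist_def)
next
  case False
  then show ?thesis by (simp add: B_def induced_basis_def Let_def r_def d_def)
qed

lemma dim_B [simp]: "dim_row (B s) = r * d" "dim_col (B s) = r * d"
  using B_carrier[of s] by simp_all

lemma B_entry:
  assumes "i < r * d" "j < r * d"
  shows "B s $$ (i, j) = (if s \<in> C \<and> ix (i div d) = sran s \<and> ix (j div d) = sdom s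
    then \<rho> (single (twist s)) $$ (i mod d, j mod d) else 0)"
proof (cases "s \<in> C")
  case True
  then have "\<rho> (single (twist s)) \<in> carrier_mat d d"
    by (intro \<rho>_carrier single_in_alg twist_in_G)
  then show ?thesis
    using True assms div_less[OF assms(1)] div_less[OF assms(2)]
    by (auto simp: B_def induced_basis_def Let_def kronecker_def matrix_unit_def r_def twist_def)
next
  case False
  then show ?thesis using assms by (simp add: B_def induced_basis_def Let_def r_def d_def)
qed

lemma sum_ix:
  assumes "a \<in> idempotents C"
  shows "(\<Sum>i<r. if ix i = a then F else 0) = (F :: complex)"
proof -
  obtain i where i: "i < r" "ix i = a" using ix_surj[OF assms] .
  then have "(\<Sum>i<r. if ix i = a then F else 0) = (\<Sum>j<r. if j = i then F else 0)"
    by (intro sum.cong) (auto simp: ix_eq_iff)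
  then show ?thesis using i by simp
qed

text \<open>Matrix units multiply like the arrows of a groupoid, and \<open>twist\<close> is multiplicative on
  composable pairs.\<close>
lemma B_mult: "B s * B t = (if sdom s = sran t then B (s * t) else 0\<^sub>m (r * d) (r * d))"
proof (rule eq_matI)
  fix i j
  assume "i < dim_row (if sdom s = sran t then B (s * t) else 0\<^sub>m (r * d) (r * d))"
    and "j < dim_col (if sdom s = sran t then B (s * t) else 0\<^sub>m (r * d) (r * d))"
  then have ij: "i < r * d" "j < r * d"
    by (auto split: if_splits)
  let ?s = "\<rho> (single (twist s))" and ?t = "\<rho> (single (twist t))"
  have "(B s * B t) $$ (i, j) = (\<Sum>l<r * d. B s $$ (i, l) * B t $$ (l, j))"
    by (rule mat_mult_entry[OF B_carrier B_carrier ij])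
  also have "\<dots> = (\<Sum>l<r * d. (if s \<in> C \<and> t \<in> C \<and> ix (i div d) = sran s \<and> ix (j div d) = sdom t
      \<and> ix (l div d) = sdom s \<and> sdom s = sran t then ?s $$ (i mod d, l mod d) * ?t $$ (l mod d, j mod d) else 0))"
    using ij by (intro sum.cong) (auto simp: B_entry)
  also have "\<dots> = (\<Sum>a<r. \<Sum>b<d. (if s \<in> C \<and> t \<in> C \<and> ix (i div d) = sran s \<and> ix (j div d) = sdom t
      \<and> ix a = sdom s \<and> sdom s = sran t then ?s $$ (i mod d, b) * ?t $$ (b, j mod d) else 0))"
    by (rule sum_lessThan_mult)
  also have "\<dots> = (if sdom s = sran t then B (s * t) else 0\<^sub>m (r * d) (r * d)) $$ (i, j)"
  proof (cases "s \<in> C \<and> sdom s = sran t \<and> ix (i div d) = sran s \<and> ix (j div d) = sdom t")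
    case True
    then have s: "s \<in> C" and st: "sdom s = sran t" by simp_all
    then have t: "t \<in> C" using C_sdom[of s] C_sran[of t] by simp
    have st': "s * t \<in> C" using s composable[OF st] C_sran[of "s * t"] C_sran[of s] by simp
    have "(\<Sum>a<r. \<Sum>b<d. (if s \<in> C \<and> t \<in> C \<and> ix (i div d) = sran s \<and> ix (j div d) = sdom t
      \<and> ix a = sdom s \<and> sdom s = sran t then ?s $$ (i mod d, b) * ?t $$ (b, j mod d) else 0))
      = (\<Sum>a<r. if ix a = sdom s then (\<Sum>b<d. ?s $$ (i mod d, b) * ?t $$ (b, j mod d)) else 0)"
      using True t by (intro sum.cong) auto
    also have "\<dots> = (\<Sum>b<d. ?s $$ (i mod d, b) * ?t $$ (b, j mod d))"
      using s by (intro sum_ix) simp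
    also have "\<dots> = (?s * ?t) $$ (i mod d, j mod d)"
      using s t twist_in_G
      by (intro mat_mult_entry[of _ d d _ d, symmetric] \<rho>_carrier single_in_alg mod_less)
    also have "?s * ?t = \<rho> (single (twist (s * t)))"
      unfolding twist_mult[OF s st] using s t twist_in_G by (intro rep_single_mult[symmetric] \<rho>_rep) simp_all
    finally show ?thesis
      using True st' composable[OF st] ij by (simp add: B_entry)
  next
    case False
    have "s * t \<in> C \<longleftrightarrow> s \<in> C" if "sdom s = sran t"
      using composable[OF that] C_sran[of "s * t"] C_sran[of s] by simp
    moreover have "(\<Sum>a<r. \<Sum>b<d. (if s \<in> C \<and> t \<in> C \<and> ix (i div d) = sran s \<and> ix (j div d) = sdom t
      \<and> ix a = sdom s \<and> sdom s = sran t then ?s $$ (i mod d, b) * ?t $$ (b, j mod d) else 0)) = 0"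
      using False by (intro sum.neutral ballI) auto
    ultimately show ?thesis
      using False composable[of s t] ij by (auto simp: B_entry)
  qed
  finally show "(B s * B t) $$ (i, j) = (if sdom s = sran t then B (s * t) else 0\<^sub>m (r * d) (r * d)) $$ (i, j)" .
qed simp_all

lemma trace_B:
  "mat_trace (B u) = (if u \<in> C \<and> sran u = sdom u then mat_trace (\<rho> (single (twist u))) else 0)"
proof -
  let ?u = "\<rho> (single (twist u))"
  have "mat_trace (B u) = (\<Sum>l<r * d. if u \<in> C \<and> sran u = sdom u \<and> ix (l div d) = sran u
      then ?u $$ (l mod d, l mod d) else 0)"
    by (simp add: mat_trace_def) (rule sum.cong, auto simp: B_entry)
  also have "\<dots> = (\<Sum>a<r. \<Sum>b<d. if u \<in> C \<and> sran u = sdom u \<and> ix a = sran u then ?u $$ (b, b) else 0)"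
    by (rule sum_lessThan_mult)
  also have "\<dots> = (if u \<in> C \<and> sran u = sdom u then \<Sum>a<r. if ix a = sran u then (\<Sum>b<d. ?u $$ (b, b)) else 0 else 0)"
    by (auto intro!: sum.cong sum.neutral)
  also have "\<dots> = (if u \<in> C \<and> sran u = sdom u then mat_trace ?u else 0)"
    using \<rho>_carrier[OF single_in_alg[OF twist_in_G[of u]]] by (auto simp: sum_ix mat_trace_def)
  finally show ?thesis .
qed

lemma \<rho>'_carrier: "\<rho>' f \<in> carrier_mat (r * d) (r * d)"
  by (simp add: \<rho>'_def induced_rep_def Let_def r_def d_def)

lemma dim_\<rho>' [simp]: "dim_row (\<rho>' f) = r * d" "dim_col (\<rho>' f) = r * d"
  using \<rho>'_carrier[of f] by simp_all

lemma rep_dim_\<rho>': "rep_dim \<rho>' = r * d"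
  by (simp add: rep_dim_def \<rho>'_def induced_rep_def Let_def r_def d_def)

lemma \<rho>'_entry:
  assumes "i < r * d" "j < r * d"
  shows "\<rho>' f $$ (i, j) = (\<Sum>s\<in>UNIV. groupoid_coeff f s * B s $$ (i, j))"
  using assms by (simp add: \<rho>'_def induced_rep_def Let_def r_def d_def B_def)

lemma \<rho>'_groupoid_basis: "\<rho>' (groupoid_basis s) = B s"
proof (rule eq_matI)
  fix i j assume "i < dim_row (B s)" "j < dim_col (B s)"
  then have ij: "i < r * d" "j < r * d" by simp_all
  have "groupoid_basis s = groupoid_sum (\<lambda>t. if t = s then 1 else 0)"
    by (simp add: groupoid_sum_def fun_eq_iff if_distrib[of "\<lambda>x. x * _"] cong: if_cong)
  then have "groupoid_coeff (groupoid_basis s) = (\<lambda>t. if t = s then 1 else 0)"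
    by (simp add: groupoid_coeff_groupoid_sum)
  then show "\<rho>' (groupoid_basis s) $$ (i, j) = B s $$ (i, j)"
    using ij by (simp add: \<rho>'_entry if_distrib[of "\<lambda>x. x * _"] cong: if_cong)
qed simp_all

lemma \<rho>'_conv: "\<rho>' (conv f g) = \<rho>' f * \<rho>' g"
proof (rule eq_matI)
  fix i j assume "i < dim_row (\<rho>' f * \<rho>' g)" "j < dim_col (\<rho>' f * \<rho>' g)"
  then have ij: "i < r * d" "j < r * d" by simp_all
  let ?f = "groupoid_coeff f" and ?g = "groupoid_coeff g"
  define P where "P = {q :: 'a \<times> 'a. sdom (fst q) = sran (snd q)}"
  have "\<rho>' (conv f g) $$ (i, j) = (\<Sum>v\<in>UNIV. (\<Sum>q\<in>{q\<in>P. fst q * snd q = v}. ?f (fst q) * ?g (snd q)) * B v $$ (i, j))"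
    using ij by (simp add: \<rho>'_entry groupoid_coeff_conv case_prod_beta' P_def)
  also have "\<dots> = (\<Sum>v\<in>UNIV. \<Sum>q\<in>{q\<in>P. fst q * snd q = v}. ?f (fst q) * ?g (snd q) * B (fst q * snd q) $$ (i, j))"
    by (intro sum.cong) (simp_all add: sum_distrib_right)
  also have "\<dots> = (\<Sum>q\<in>P. ?f (fst q) * ?g (snd q) * B (fst q * snd q) $$ (i, j))"
    by (rule sum.group) simp_all
  also have "\<dots> = (\<Sum>q\<in>UNIV. ?f (fst q) * ?g (snd q) * (B (fst q) * B (snd q)) $$ (i, j))"
    using ij by (intro sum.mono_neutral_cong_left) (auto simp: P_def B_mult)
  also have "\<dots> = (\<Sum>t\<in>UNIV. \<Sum>u\<in>UNIV. ?f t * ?g u * (\<Sum>l<r * d. B t $$ (i, l) * B u $$ (l, j)))"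
    by (simp add: mat_mult_entry[OF B_carrier B_carrier ij] sum.cartesian_product case_prod_beta')
  also have "\<dots> = (\<Sum>t\<in>UNIV. \<Sum>u\<in>UNIV. \<Sum>l<r * d. (?f t * B t $$ (i, l)) * (?g u * B u $$ (l, j)))"
    by (simp add: sum_distrib_left mult_ac)
  also have "\<dots> = (\<Sum>l<r * d. \<Sum>t\<in>UNIV. \<Sum>u\<in>UNIV. (?f t * B t $$ (i, l)) * (?g u * B u $$ (l, j)))"
    by (subst sum.swap[of _ _ "{..<r * d}"], subst sum.swap[of _ _ "{..<r * d}"]) (rule refl)
  also have "\<dots> = (\<Sum>l<r * d. \<rho>' f $$ (i, l) * \<rho>' g $$ (l, j))"
    using ij by (simp add: \<rho>'_entry sum_product)
  also have "\<dots> = (\<rho>' f * \<rho>' g) $$ (i, j)"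
    by (rule mat_mult_entry[OF \<rho>'_carrier \<rho>'_carrier ij, symmetric])
  finally show "\<rho>' (conv f g) $$ (i, j) = (\<rho>' f * \<rho>' g) $$ (i, j)" .
qed simp_all

lemma is_rep_\<rho>': "is_rep UNIV \<rho>'"
  unfolding is_rep_def rep_dim_\<rho>'
proof (intro conjI ballI allI)
  fix f g c
  show "\<rho>' (\<lambda>x. f x + g x) = \<rho>' f + \<rho>' g"
  proof (rule eq_matI)
    fix i j assume "i < dim_row (\<rho>' f + \<rho>' g)" "j < dim_col (\<rho>' f + \<rho>' g)"
    then have ij: "i < r * d" "j < r * d" by simp_all
    then show "\<rho>' (\<lambda>x. f x + g x) $$ (i, j) = (\<rho>' f + \<rho>' g) $$ (i, j)"
      by (simp add: \<rho>'_entry groupoid_coeff_eq sum.distrib distrib_right)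
  qed simp_all
  show "\<rho>' (\<lambda>x. c * f x) = c \<cdot>\<^sub>m \<rho>' f"
  proof (rule eq_matI)
    fix i j assume "i < dim_row (c \<cdot>\<^sub>m \<rho>' f)" "j < dim_col (c \<cdot>\<^sub>m \<rho>' f)"
    then have ij: "i < r * d" "j < r * d" by simp_all
    then show "\<rho>' (\<lambda>x. c * f x) $$ (i, j) = (c \<cdot>\<^sub>m \<rho>' f) $$ (i, j)"
      by (simp add: \<rho>'_entry groupoid_coeff_eq mult.assoc flip: sum_distrib_left)
  qed simp_all
qed (simp_all add: \<rho>'_conv \<rho>'_carrier)

text \<open>The element whose image under \<open>\<rho>'\<close> has the block \<open>\<rho> f\<close> at \<open>(a, b)\<close> and
  zeros elsewhere.\<close>
definition corner :: "nat \<Rightarrow> nat \<Rightarrow> ('a \<Rightarrow> complex) \<Rightarrow> 'a \<Rightarrow> complex" where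
  "corner a b f = groupoid_sum (\<lambda>s. if sran s = ix a \<and> sdom s = ix b then f (twist s) else 0)"

lemma \<rho>'_corner:
  assumes f: "f \<in> alg G" and ab: "a < r" "b < r" and ij: "i < r * d" "j < r * d"
  shows "\<rho>' (corner a b f) $$ (i, j)
    = (if i div d = a \<and> j div d = b then \<rho> f $$ (i mod d, j mod d) else 0)"
proof -
  have inC: "s \<in> C" if "sran s = ix a" for s
    using that ix_idem[OF ab(1)] C_sran[of s] by (simp add: idempotents_def)
  have "\<rho>' (corner a b f) $$ (i, j) = (\<Sum>s\<in>UNIV. if sran s = ix a \<and> sdom s = ix b then f (twist s) * B s $$ (i, j) else 0)"
    using ij by (simp add: \<rho>'_entry corner_def groupoid_coeff_groupoid_sum if_distrib[of "\<lambda>x. x * _"] cong: if_cong)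
  also have "\<dots> = (\<Sum>s | sran s = ix a \<and> sdom s = ix b. f (twist s) * B s $$ (i, j))"
    by (simp add: sum.If_cases)
  also have "\<dots> = (\<Sum>s | sran s = ix a \<and> sdom s = ix b. if i div d = a \<and> j div d = b
      then f (twist s) * \<rho> (single (twist s)) $$ (i mod d, j mod d) else 0)"
    using ij ab div_less[OF ij(1)] div_less[OF ij(2)] inC
    by (intro sum.cong) (auto simp: B_entry ix_eq_iff)
  also have "\<dots> = (\<Sum>h\<in>G. if i div d = a \<and> j div d = b
      then f h * \<rho> (single h) $$ (i mod d, j mod d) else 0)"
    by (rule sum.reindex_bij_betw[OF bij_betw_twist[OF ix_idem ix_idem]]) (rule ab)+
  also have "\<dots> = (if i div d = a \<and> j div d = b then \<rho> f $$ (i mod d, j mod d) else 0)"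
  proof (cases "i div d = a \<and> j div d = b")
    case True
    then show ?thesis
      using rep_expand[OF \<rho>_rep f, folded d_def, OF mod_less mod_less, of i j] by simp
  next
    case False
    then show ?thesis by (simp only: if_False sum.neutral_const)
  qed
  finally show ?thesis .
qed

definition block :: "nat \<Rightarrow> complex vec \<Rightarrow> complex vec" where
  "block b w = vec d (\<lambda>l. w $ (b * d + l))"

definition embed :: "nat \<Rightarrow> complex vec \<Rightarrow> complex vec" where
  "embed a v = vec (r * d) (\<lambda>l. if l div d = a then v $ (l mod d) else 0)"

lemma block_carrier [simp]: "block b w \<in> carrier_vec d"
  and embed_carrier [simp]: "embed a v \<in> carrier_vec (r * d)"
  by (simp_all add: block_def embed_def)

lemma index_bound: "a < r \<Longrightarrow> l < d \<Longrightarrow> a * d + l < r * d"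
proof -
  assume "a < r" "l < d"
  then have "a * d + l < Suc a * d" "Suc a * d \<le> r * d" by (simp, intro mult_le_mono1) simp
  then show ?thesis by linarith
qed

lemma block_embed:
  assumes "a < r" "v \<in> carrier_vec d"
  shows "block a (embed a v) = v"
  using assms by (intro eq_vecI) (auto simp: block_def embed_def index_bound)

lemma \<rho>'_corner_mult:
  assumes f: "f \<in> alg G" and ab: "a < r" "b < r" and w: "w \<in> carrier_vec (r * d)"
  shows "\<rho>' (corner a b f) *\<^sub>v w = embed a (\<rho> f *\<^sub>v block b w)"
proof (rule eq_vecI)
  fix i assume "i < dim_vec (embed a (\<rho> f *\<^sub>v block b w))"
  then have i: "i < r * d" by (simp add: embed_def)
  have "(\<rho>' (corner a b f) *\<^sub>v w) $ i = (\<Sum>l<r * d. \<rho>' (corner a b f) $$ (i, l) * w $ l)"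
    by (rule mult_mat_vec_entry[OF \<rho>'_carrier w i])
  also have "\<dots> = (\<Sum>l<r * d. if i div d = a \<and> l div d = b
      then \<rho> f $$ (i mod d, l mod d) * w $ (l div d * d + l mod d) else 0)"
    using i by (intro sum.cong) (auto simp: \<rho>'_corner[OF f ab])
  also have "\<dots> = (\<Sum>c<r. \<Sum>l<d. if i div d = a \<and> c = b then \<rho> f $$ (i mod d, l) * w $ (c * d + l) else 0)"
    by (rule sum_lessThan_mult)
  also have "\<dots> = (\<Sum>c<r. if c = b then (\<Sum>l<d. if i div d = a then \<rho> f $$ (i mod d, l) * w $ (b * d + l) else 0) else 0)"
    by (intro sum.cong) auto
  also have "\<dots> = (if i div d = a then \<Sum>l<d. \<rho> f $$ (i mod d, l) * w $ (b * d + l) else 0)"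
    using ab by simp
  also have "\<dots> = (if i div d = a then (\<rho> f *\<^sub>v block b w) $ (i mod d) else 0)"
    using mult_mat_vec_entry[OF \<rho>_carrier[OF f] block_carrier mod_less, of b w i]
    by (simp add: block_def del: index_mult_mat_vec)
  also have "\<dots> = embed a (\<rho> f *\<^sub>v block b w) $ i"
    using i by (simp add: embed_def)
  finally show "(\<rho>' (corner a b f) *\<^sub>v w) $ i = embed a (\<rho> f *\<^sub>v block b w) $ i" .
qed (simp add: embed_def)

text \<open>A nonzero vector of an invariant subspace \<open>W\<close> has a nonzero block, and the corner elements
  move this block to any other position. Hence, for each position \<open>a\<close>, the vectors whose
  embedding at \<open>a\<close> lies in \<open>W\<close> form a nonzero invariant subspace for \<open>\<rho>\<close>, which
  must be everything, and these embeddings span the whole space.\<close>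
theorem irreducible_\<rho>': "irreducible_rep UNIV \<rho>'"
  unfolding irreducible_rep_def rep_dim_\<rho>'
proof (intro conjI allI impI)
  show "is_rep UNIV \<rho>'" by (rule is_rep_\<rho>')
  note unit = single_in_alg[OF G_closed(1)]
  have rd: "0 < r * d" using r_pos d_pos by simp
  have "\<rho>' (corner 0 0 (single e)) $$ (0, 0) = 1"
    using \<rho>'_corner[OF unit r_pos r_pos rd rd] irreducible_unit[OF \<rho>] d_pos by (simp add: d_def)
  then have "\<rho>' (corner 0 0 (single e)) \<noteq> 0\<^sub>m (r * d) (r * d)"
    using rd by (metis index_zero_mat(1) zero_neq_one)
  then show "\<exists>f\<in>alg UNIV. \<rho>' f \<noteq> 0\<^sub>m (r * d) (r * d)" by (auto simp: alg_def)
next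
  fix W
  assume W: "VectorSpace.subspace class_ring W (module_vec TYPE(complex) (r * d)) \<and>
    (\<forall>f\<in>alg UNIV. \<forall>v\<in>W. \<rho>' f *\<^sub>v v \<in> W)"
  then have inv: "\<rho>' f *\<^sub>v v \<in> W" if "v \<in> W" for f v
    using that by (auto simp: alg_def)
  note WD = subspaceD[OF conjunct1[OF W]]
  note unit = single_in_alg[OF G_closed(1)]
  have corner: "embed a (\<rho> f *\<^sub>v block b w) \<in> W" if "f \<in> alg G" "a < r" "b < r" "w \<in> W" for f a b w
    using inv[OF that(4), of "corner a b f"] \<rho>'_corner_mult[OF that(1-3), of w] WD(1) that(4) by auto
  show "W = {0\<^sub>v (r * d)} \<or> W = carrier_vec (r * d)"
  proof (rule disjCI)
    assume "W \<noteq> carrier_vec (r * d)"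
    have False if "w \<in> W" and w_nonzero: "w \<noteq> 0\<^sub>v (r * d)" for w
    proof -
      have w: "w \<in> carrier_vec (r * d)" using that WD(1) by blast
      then obtain l where l: "l < r * d" "w $ l \<noteq> 0"
        using w_nonzero by (metis eq_vecI carrier_vecD index_zero_vec)
      define b where "b = l div d"
      have b: "b < r" using div_less[OF l(1)] by (simp add: b_def)
      have "block b w $ (l mod d) \<noteq> 0"
        using l d_pos by (simp add: block_def b_def)
      then have nz: "block b w \<noteq> 0\<^sub>v d" using d_pos by (metis index_zero_vec(1) mod_less)
      have all: "embed a v \<in> W" if a: "a < r" and v: "v \<in> carrier_vec d" for a v
      proof -
        let ?U = "{v \<in> carrier_vec d. embed a v \<in> W}"
        have "VectorSpace.subspace class_ring ?U (module_vec TYPE(complex) d)"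
        proof (rule subspaceI)
          have "embed a (0\<^sub>v d) = 0\<^sub>v (r * d)"
            using d_pos by (intro eq_vecI) (auto simp: embed_def)
          then show "0\<^sub>v d \<in> ?U" using WD(2) by simp
          show "v + w \<in> ?U" if "v \<in> ?U" "w \<in> ?U" for v w
          proof -
            have "embed a (v + w) = embed a v + embed a w"
              using that d_pos by (intro eq_vecI) (auto simp: embed_def)
            then show ?thesis using that WD(3) by auto
          qed
          show "c \<cdot>\<^sub>v v \<in> ?U" if "v \<in> ?U" for c v
          proof -
            have "embed a (c \<cdot>\<^sub>v v) = c \<cdot>\<^sub>v embed a v"
              using that d_pos by (intro eq_vecI) (auto simp: embed_def)
            then show ?thesis using that WD(4) by auto
          qed
        qed auto
        moreover have "\<rho> f *\<^sub>v v \<in> ?U" if "f \<in> alg G" "v \<in> ?U" for f v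
          using corner[OF that(1) a a, of "embed a v"] that \<rho>_carrier[OF that(1)]
          by (auto simp: block_embed[OF a])
        ultimately have "?U = {0\<^sub>v d} \<or> ?U = carrier_vec d"
          using irreducibleD[OF \<rho>, folded d_def, of ?U] by blast
        moreover have "block b w \<in> ?U"
          using corner[OF unit a b \<open>w \<in> W\<close>] irreducible_unit[OF \<rho>] by (simp add: d_def[symmetric])
        ultimately show ?thesis using nz v by blast
      qed
      have "x \<in> W" if x: "x \<in> carrier_vec (r * d)" for x
      proof -
        \<comment> \<open>The first \<open>n\<close> blocks of \<open>x\<close> are added up one after the other.\<close>
        have "vec (r * d) (\<lambda>l. if l div d < n then x $ l else 0) \<in> W" if "n \<le> r" for n
          using that
        proof (induction n)
          case 0
          have "vec (r * d) (\<lambda>l. 0 :: complex) = 0\<^sub>v (r * d)" by (intro eq_vecI) auto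
          then show ?case using WD(2) by simp
        next
          case (Suc n)
          have "vec (r * d) (\<lambda>l. if l div d < Suc n then x $ l else 0)
            = vec (r * d) (\<lambda>l. if l div d < n then x $ l else 0) + embed n (block n x)"
            using d_pos by (intro eq_vecI) (auto simp: embed_def block_def less_Suc_eq)
          then show ?case using Suc all WD(3) by simp
        qed
        from this[of r] have "vec (r * d) (\<lambda>l. if l div d < r then x $ l else 0) \<in> W" by simp
        also have "vec (r * d) (\<lambda>l. if l div d < r then x $ l else 0) = x"
          using x div_less by (intro eq_vecI) auto
        finally show ?thesis .
      qed
      with \<open>W \<noteq> carrier_vec (r * d)\<close> WD(1) show False by blast
    qed
    then show "W = {0\<^sub>v (r * d)}" using WD(2) by blast
  qed
qed

section \<open>Fourier inversion\<close>

text \<open>By \<open>B_mult\<close> a term with \<open>dom t \<noteq> dom s\<close> vanishes, and for the others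
  \<open>ts\<^sup>-\<^sup>1\<close> has domain \<open>ran s\<close> and range \<open>ran t\<close>, so it lies off the diagonal
  unless \<open>ran t = ran s\<close>.\<close>
lemma trace_\<rho>':
  assumes s: "s \<in> C"
  shows "mat_trace (\<rho>' (groupoid_sum g) * \<rho>' (groupoid_basis (sinv s)))
    = (\<Sum>t | sran t = sran s \<and> sdom t = sdom s. g t * mat_trace (\<rho> (single (twist (t * sinv s)))))"
proof -
  let ?T = "{t. sran t = sran s \<and> sdom t = sdom s}"
  have "mat_trace (\<rho>' (groupoid_sum g) * B (sinv s))
    = (\<Sum>i<r * d. \<Sum>l<r * d. (\<Sum>t\<in>UNIV. g t * B t $$ (i, l)) * B (sinv s) $$ (l, i))"
    by (simp add: mat_trace_def mat_mult_entry[OF \<rho>'_carrier B_carrier] \<rho>'_entry groupoid_coeff_groupoid_sum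
      del: index_mult_mat(1))
  also have "\<dots> = (\<Sum>i<r * d. \<Sum>t\<in>UNIV. \<Sum>l<r * d. g t * (B t $$ (i, l) * B (sinv s) $$ (l, i)))"
    by (subst sum.swap) (simp add: sum_distrib_right mult.assoc)
  also have "\<dots> = (\<Sum>t\<in>UNIV. \<Sum>i<r * d. g t * (B t * B (sinv s)) $$ (i, i))"
    by (subst sum.swap) (simp add: mat_mult_entry[OF B_carrier B_carrier] sum_distrib_left del: index_mult_mat(1))
  also have "\<dots> = (\<Sum>t\<in>UNIV. g t * mat_trace (B t * B (sinv s)))"
    by (simp add: mat_trace_def sum_distrib_left)
  also have "\<dots> = (\<Sum>t\<in>?T. g t * mat_trace (\<rho> (single (twist (t * sinv s)))))"
  proof (rule sum.mono_neutral_cong_right)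
    have tr: "mat_trace (B t * B (sinv s)) = (if t \<in> ?T then mat_trace (\<rho> (single (twist (t * sinv s)))) else 0)" for t
    proof (cases "sdom t = sdom s")
      case True
      then have c: "sdom (t * sinv s) = sran s" "sran (t * sinv s) = sran t"
        using composable[of t "sinv s"] by simp_all
      then have "t * sinv s \<in> C" using C_sdom[of "t * sinv s"] s by simp
      then show ?thesis using True c by (simp add: B_mult trace_B)
    next
      case False
      then show ?thesis by (simp add: B_mult mat_trace_def)
    qed
    show "\<forall>t\<in>UNIV - ?T. g t * mat_trace (B t * B (sinv s)) = 0"
    proof
      fix t assume "t \<in> UNIV - ?T"
      then have "t \<notin> ?T" by blast
      then show "g t * mat_trace (B t * B (sinv s)) = 0"
        by (simp only: tr if_False mult_zero_right)
    qed
    show "g t * mat_trace (B t * B (sinv s)) = g t * mat_trace (\<rho> (single (twist (t * sinv s))))" if "t \<in> ?T" for t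
      using tr[of t] that by simp
  qed simp_all
  finally show ?thesis by (simp add: \<rho>'_groupoid_basis)
qed

end

context D_class begin

text \<open>By \<open>twist_eq_unit\<close>, column orthogonality singles out the term \<open>t = s\<close>.\<close>
lemma inversion_formula:
  assumes I: "complete_irreps G I" and X: "complete_irreps UNIV X" and s: "s \<in> C"
  shows "(\<Sum>\<rho>\<in>I. let \<rho>t = equiv_rep_in UNIV X (induced_rep C ix p \<rho>) in
       of_nat (rep_dim \<rho>) * mat_trace (\<rho>t (groupoid_sum g) * \<rho>t (groupoid_basis (sinv s))))
    = of_nat (card G) * g s"
proof -
  let ?T = "{t. sran t = sran s \<and> sdom t = sdom s}"
  have summand: "(let \<rho>t = equiv_rep_in UNIV X (induced_rep C ix p \<rho>) in
       of_nat (rep_dim \<rho>) * mat_trace (\<rho>t (groupoid_sum g) * \<rho>t (groupoid_basis (sinv s))))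
    = (\<Sum>t\<in>?T. g t * (of_nat (rep_dim \<rho>) * mat_trace (\<rho> (single (twist (t * sinv s))))))" if \<rho>: "\<rho> \<in> I" for \<rho>
  proof -
    interpret induction_from_subgroup C e p ix G r \<rho> "rep_dim \<rho>" "induced_basis C ix p \<rho>" "induced_rep C ix p \<rho>"
      using complete_irrepsD(1)[OF I \<rho>] by unfold_locales (simp_all add: G_def r_def)
    let ?\<rho>' = "induced_rep C ix p \<rho>"
    define \<rho>t where "\<rho>t = equiv_rep_in UNIV X ?\<rho>'"
    have "\<exists>!\<sigma>. \<sigma> \<in> X \<and> equiv_rep UNIV ?\<rho>' \<sigma>"
      using X irreducible_\<rho>' by (auto simp: complete_irreps_def)
    from theI'[OF this] have \<rho>t: "\<rho>t \<in> X" "equiv_rep UNIV ?\<rho>' \<rho>t"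
      by (auto simp: \<rho>t_def equiv_rep_in_def)
    have all: "f \<in> alg UNIV" for f :: "'a \<Rightarrow> complex" by (simp add: alg_def)
    note rep = irreducible_is_rep[OF complete_irrepsD(1)[OF X \<rho>t(1)]]
    have "mat_trace (\<rho>t (groupoid_sum g) * \<rho>t (groupoid_basis (sinv s)))
      = mat_trace (\<rho>t (conv (groupoid_sum g) (groupoid_basis (sinv s))))"
      by (simp add: is_repD(4)[OF rep all all])
    also have "\<dots> = mat_trace (?\<rho>' (conv (groupoid_sum g) (groupoid_basis (sinv s))))"
      by (rule equiv_rep_trace[OF \<rho>t(2) all, symmetric])
    also have "\<dots> = (\<Sum>t\<in>?T. g t * mat_trace (\<rho> (single (twist (t * sinv s)))))"
      by (simp add: \<rho>'_conv trace_\<rho>'[OF s])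
    finally show ?thesis
      by (simp add: Let_def \<rho>t_def sum_distrib_left mult.left_commute)
  qed
  have twist: "twist (t * sinv s) \<in> G \<and> (twist (t * sinv s) = e \<longleftrightarrow> t = s)" if "t \<in> ?T" for t
  proof -
    have c: "sdom (t * sinv s) = sran s" "sran (t * sinv s) = sran s"
      using composable[of t "sinv s"] that by simp_all
    then have C: "t * sinv s \<in> C" using C_sdom[of "t * sinv s"] s by simp
    have "t = s" if "twist (t * sinv s) = e"
    proof -
      have "t * sinv s = sran s" using twist_eq_unit[OF C] c that by simp
      then have "t * sdom s = s" by (simp add: sdom_def flip: mult.assoc)
      moreover have "sdom t = sdom s" using \<open>t \<in> ?T\<close> by blast
      ultimately show ?thesis using mult_sdom[of t] by metis
    qed
    moreover have "twist (s * sinv s) = e"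
    proof -
      have s': "sinv s \<in> C" using C_sran[of "sinv s"] s by simp
      have "twist (s * sinv s) * twist (s * sinv s) = twist (s * sinv s)"
        using twist_mult[of "sran s" "sran s"] s by (simp add: sdom_of_idempotent sran_of_idempotent flip: sran_def)
      moreover have "twist (s * sinv s) \<in> G" using twist_in_G[of "sran s"] s by (simp flip: sran_def)
      ultimately show ?thesis by (metis G_cancel(1) G_inverse(1))
    qed
    ultimately show ?thesis using twist_in_G[OF C] by blast
  qed
  have "(\<Sum>\<rho>\<in>I. let \<rho>t = equiv_rep_in UNIV X (induced_rep C ix p \<rho>) in
       of_nat (rep_dim \<rho>) * mat_trace (\<rho>t (groupoid_sum g) * \<rho>t (groupoid_basis (sinv s))))
    = (\<Sum>\<rho>\<in>I. \<Sum>t\<in>?T. g t * (of_nat (rep_dim \<rho>) * mat_trace (\<rho> (single (twist (t * sinv s))))))"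
    by (intro sum.cong refl summand)
  also have "\<dots> = (\<Sum>t\<in>?T. g t * (\<Sum>\<rho>\<in>I. of_nat (rep_dim \<rho>) * mat_trace (\<rho> (single (twist (t * sinv s))))))"
    by (subst sum.swap) (simp add: sum_distrib_left)
  also have "\<dots> = (\<Sum>t\<in>?T. if t = s then g t * of_nat (card G) else 0)"
    using twist by (intro sum.cong) (auto simp: column_orthogonality(2)[OF I])
  also have "\<dots> = of_nat (card G) * g s"
    by simp
  finally show ?thesis .
qed

end

theorem theorem3p3:
  fixes n k :: nat
    and D :: "nat \<Rightarrow> 'a::{inverse_semigroup, finite} set"
    and e :: "nat \<Rightarrow> 'a"
    and IRR :: "nat \<Rightarrow> 'a rep set"
    and p :: "'a \<Rightarrow> 'a"
    and ix :: "nat \<Rightarrow> nat \<Rightarrow> 'a"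
    and X :: "'a rep set"
    and g :: "'a \<Rightarrow> complex"
    and s :: 'a
  assumes D_classes: "bij_betw D {..n} (UNIV // (D_rel :: ('a \<times> 'a) set))"
    and e: "\<forall>j\<le>n. e j \<in> idempotents (D j)"
    and IRR: "\<forall>j\<le>n. complete_irreps (max_subgroup (e j)) (IRR j)"
    and p: "\<forall>j\<le>n. \<forall>f\<in>idempotents (D j). sdom (p f) = e j \<and> sran (p f) = f"
    and p_e: "\<forall>j\<le>n. p (e j) = e j"
    and ix: "\<forall>j\<le>n. bij_betw (ix j) {..<card (idempotents (D j))} (idempotents (D j))"
    and X: "complete_irreps UNIV X"
    and k: "k \<le> n"
    and s: "s \<in> D k"
  shows "g s = 1 / of_nat (card (max_subgroup (e k))) *
    (\<Sum>\<rho>\<in>IRR k.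
       let \<rho>t = equiv_rep_in UNIV X (induced_rep (D k) (ix k) p \<rho>) in
       of_nat (rep_dim \<rho>) * mat_trace (\<rho>t (groupoid_sum g) * \<rho>t (groupoid_basis (sinv s))))"
proof -
  interpret D_class "D k" "e k" p "ix k" "max_subgroup (e k)" "card (idempotents (D k))"
    using D_classes e p ix k by unfold_locales (auto simp: bij_betw_def)
  have "complete_irreps (max_subgroup (e k)) (IRR k)" using IRR k by blast
  from inversion_formula[OF this X s, of g] show ?thesis
    using card_G_pos by (simp only:) auto
qed

end
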